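(* Let $\mathbf{k}$ be a field. Every semi-standard object of $\mathcal{A}$ is standard.
   Context: Let $\mathfrak{S}=\bigcup_{n\ge1}\mathfrak{S}_n$ be the infinite symmetric group (finitary permutations of $\{1,2,\ldots\}$), and $\mathfrak{S}^n\subset\mathfrak{S}$ the subgroup fixing each of $1,\ldots,n$. Let $\mathbf{K}=\mathbf{k}(\xi_1,\xi_2,\ldots)$, on which $\mathfrak{S}$ acts by permuting variables. $\mathcal{A}$ is the category of smooth $\mathbf{K}$-semilinear representations of $\mathfrak{S}$: $\mathbf{K}$-vector spaces $M$ with an additive action of $\mathfrak{S}$ satisfying $\sigma(av)=(\sigma a)(\sigma v)$, such that every $v\in M$ is fixed by $\mathfrak{S}^n$ for some $n$. Morphisms are $\mathbf{K}$-linear $\mathfrak{S}$-equivariant maps. $\mathbf{I}^r=\mathbf{K}\otimes_{\mathbf{k}}\mathbf{V}^r$, where $\mathbf{V}^r$ is the $\mathbf{k}$-vector space with basis $\{e_S\}$ indexed by the $r$-element subsets $S$ of $\{1,2,\ldots\}$, permuted by $\mathfrak{S}$. An object of $\mathcal{A}$ is standard if it is isomorphic to a direct sum of objects of the form $\mathbf{I}^r$ ($r\ge0$ allowed to vary), and semi-standard if it admits a finite filtration whose graded pieces are standard. *)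

theory Defs
  imports
    "HOL-Library.Poly_Mapping"
    "HOL-Computational_Algebra.Fraction_Field"
    "HOL-Combinatorics.Permutations"
    "HOL-Algebra.Module"
    "HOL-Algebra.AbelCoset"
begin

section \<open>The infinite symmetric group\<close>

text \<open>The permuted points (and hence the variables) are numbered from \<open>0\<close>, so that
  \<open>{1, \<dots>, n}\<close> becomes \<open>{..<n}\<close>.\<close>

definition inf_sym :: "(nat \<Rightarrow> nat) set" where
  "inf_sym = (\<Union>n\<in>{1..}. {\<sigma>. \<sigma> permutes {..<n}})"

definition inf_sym_fix :: "nat \<Rightarrow> (nat \<Rightarrow> nat) set" where
  "inf_sym_fix n = {\<sigma> \<in> inf_sym. \<forall>i<n. \<sigma> i = i}"

lemma inf_sym_bij: "\<sigma> \<in> inf_sym \<Longrightarrow> bij \<sigma>"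
  by (auto simp: inf_sym_def permutes_bij)

lemma inf_sym_id: "id \<in> inf_sym"
  by (auto simp: inf_sym_def permutes_id)

lemma inf_sym_comp:
  assumes "\<sigma> \<in> inf_sym" "\<tau> \<in> inf_sym"
  shows "\<sigma> \<circ> \<tau> \<in> inf_sym"
proof -
  obtain m n where "\<sigma> permutes {..<m}" "\<tau> permutes {..<n}" "m \<ge> 1"
    using assms by (auto simp: inf_sym_def)
  then have "\<sigma> permutes {..<max m n}" "\<tau> permutes {..<max m n}"
    by (auto intro: permutes_subset)
  then show ?thesis
    using \<open>m \<ge> 1\<close> by (auto simp: inf_sym_def intro!: bexI[of _ "max m n"] permutes_compose)
qed


section \<open>The field of rational functions in countably many variables\<close>

type_synonym 'k ratfun = "((nat \<Rightarrow>\<^sub>0 nat) \<Rightarrow>\<^sub>0 'k) fract"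

definition pushforward :: "('a \<Rightarrow> 'b) \<Rightarrow> ('a \<Rightarrow>\<^sub>0 'c::comm_monoid_add) \<Rightarrow> 'b \<Rightarrow>\<^sub>0 'c" where
  "pushforward f p = (\<Sum>x\<in>Poly_Mapping.keys p. Poly_Mapping.single (f x) (Poly_Mapping.lookup p x))"

lemma pushforward_superset:
  assumes "finite A" "Poly_Mapping.keys p \<subseteq> A"
  shows "pushforward f p = (\<Sum>x\<in>A. Poly_Mapping.single (f x) (Poly_Mapping.lookup p x))"
  unfolding pushforward_def
  by (rule sum.mono_neutral_left) (use assms in \<open>auto simp: in_keys_iff\<close>)

lemma pushforward_zero [simp]: "pushforward f 0 = 0"
  by (simp add: pushforward_def)

lemma pushforward_add: "pushforward f (p + q) = pushforward f p + pushforward f q"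
proof -
  have "Poly_Mapping.keys (p + q) \<subseteq> Poly_Mapping.keys p \<union> Poly_Mapping.keys q"
    by (rule Poly_Mapping.keys_add)
  then show ?thesis
    by (simp add: pushforward_superset[of "Poly_Mapping.keys p \<union> Poly_Mapping.keys q"] lookup_add single_add sum.distrib)
qed

lemma pushforward_single [simp]:
  "pushforward f (Poly_Mapping.single x c) = Poly_Mapping.single (f x) c"
  by (cases "c = 0") (simp_all add: pushforward_def)

lemma poly_mapping_sum_monomials:
  fixes p :: "'a \<Rightarrow>\<^sub>0 'c::comm_monoid_add"
  shows "(\<Sum>x\<in>Poly_Mapping.keys p. Poly_Mapping.single x (Poly_Mapping.lookup p x)) = p"
proof (rule poly_mapping_eqI)
  fix y
  have "Poly_Mapping.lookup (\<Sum>x\<in>Poly_Mapping.keys p.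
      Poly_Mapping.single x (Poly_Mapping.lookup p x)) y =
    (\<Sum>x\<in>Poly_Mapping.keys p. if x = y then Poly_Mapping.lookup p x else 0)"
    by (simp add: Poly_Mapping.lookup_sum lookup_single when_def)
  also have "\<dots> = Poly_Mapping.lookup p y"
    by (simp add: in_keys_iff)
  finally show "Poly_Mapping.lookup (\<Sum>x\<in>Poly_Mapping.keys p.
      Poly_Mapping.single x (Poly_Mapping.lookup p x)) y = Poly_Mapping.lookup p y" .
qed

lemma poly_mapping_additive_induct [case_names zero single add]:
  fixes P :: "('a \<Rightarrow>\<^sub>0 'c::comm_monoid_add) \<Rightarrow> bool"
  assumes "P 0" "\<And>x c. P (Poly_Mapping.single x c)"
    and "\<And>p q. P p \<Longrightarrow> P q \<Longrightarrow> P (p + q)"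
  shows "P p"
proof -
  have "P (\<Sum>x\<in>A. Poly_Mapping.single x (Poly_Mapping.lookup p x))" if "finite A" for A
    using that by induction (auto intro: assms)
  from this[of "Poly_Mapping.keys p"] show ?thesis
    by (simp add: poly_mapping_sum_monomials)
qed

lemma pushforward_mult:
  fixes p q :: "'a::comm_monoid_add \<Rightarrow>\<^sub>0 'c::comm_semiring_1"
  assumes "\<And>x y. f (x + y) = f x + f y"
  shows "pushforward f (p * q) = pushforward f p * pushforward f q"
proof (induction p rule: poly_mapping_additive_induct)
  case (single x c)
  show ?case
    by (induction q rule: poly_mapping_additive_induct)
       (simp_all add: mult_single assms distrib_left pushforward_add)
qed (simp_all add: distrib_right pushforward_add)

lemma pushforward_comp: "pushforward f (pushforward g p) = pushforward (f \<circ> g) p"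
  by (induction p rule: poly_mapping_additive_induct) (simp_all add: pushforward_add)

lemma pushforward_cong:
  "(\<And>x. x \<in> Poly_Mapping.keys p \<Longrightarrow> f x = g x) \<Longrightarrow> pushforward f p = pushforward g p"
  by (simp add: pushforward_def)

lemma pushforward_id [simp]: "pushforward id p = p" "pushforward (\<lambda>x. x) p = p"
  by (simp_all add: pushforward_def poly_mapping_sum_monomials)

lemma inj_pushforward:
  assumes "inj f"
  shows "inj (pushforward f)"
proof (rule inj_on_inverseI)
  show "pushforward (inv_into UNIV f) (pushforward f p) = p" for p :: "'a \<Rightarrow>\<^sub>0 'c::comm_monoid_add"
    using assms by (simp add: pushforward_comp)
qed

text \<open>The substitution \<open>\<xi>\<^sub>i \<mapsto> \<xi>\<^bsub>\<sigma> i\<^esub>\<close>: the inner \<^const>\<open>pushforward\<close> renames the variables of a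
  monomial (given by its exponents), the outer one applies this to each monomial of a polynomial.\<close>

definition poly_act ::
  "(nat \<Rightarrow> nat) \<Rightarrow> ((nat \<Rightarrow>\<^sub>0 nat) \<Rightarrow>\<^sub>0 'k::field) \<Rightarrow> (nat \<Rightarrow>\<^sub>0 nat) \<Rightarrow>\<^sub>0 'k" where
  "poly_act \<sigma> = pushforward (pushforward \<sigma>)"

lemma poly_act_zero [simp]: "poly_act \<sigma> 0 = 0"
  by (simp add: poly_act_def)

lemma poly_act_add: "poly_act \<sigma> (p + q) = poly_act \<sigma> p + poly_act \<sigma> q"
  by (simp add: poly_act_def pushforward_add)

lemma poly_act_mult: "poly_act \<sigma> (p * q) = poly_act \<sigma> p * poly_act \<sigma> q"
  by (simp add: poly_act_def pushforward_mult pushforward_add)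

lemma poly_act_one [simp]: "poly_act \<sigma> 1 = 1"
  by (simp add: poly_act_def flip: single_one)

lemma poly_act_eq_0_iff: "bij \<sigma> \<Longrightarrow> poly_act \<sigma> p = 0 \<longleftrightarrow> p = 0"
  unfolding poly_act_def
  by (metis bij_is_inj inj_pushforward injD pushforward_zero)

text \<open>The value for non-bijective \<open>\<sigma>\<close> is irrelevant.\<close>

lift_definition ratfun_act :: "(nat \<Rightarrow> nat) \<Rightarrow> 'k::field ratfun \<Rightarrow> 'k ratfun"
  is "\<lambda>\<sigma> (a, b). if bij \<sigma> then (poly_act \<sigma> a, poly_act \<sigma> b) else (a, b)"
  by (auto simp: poly_act_eq_0_iff split: if_splits simp flip: poly_act_mult)

lemma ratfun_act_Fract:
  "bij \<sigma> \<Longrightarrow> ratfun_act \<sigma> (Fract a b) = Fract (poly_act \<sigma> a) (poly_act \<sigma> b)"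
  by transfer (auto simp: poly_act_eq_0_iff)

lemma ratfun_act_add:
  assumes "bij \<sigma>"
  shows "ratfun_act \<sigma> (x + y) = ratfun_act \<sigma> x + ratfun_act \<sigma> y"
  by (cases x; cases y)
     (simp add: ratfun_act_Fract poly_act_eq_0_iff poly_act_add poly_act_mult assms)

lemma ratfun_act_mult:
  assumes "bij \<sigma>"
  shows "ratfun_act \<sigma> (x * y) = ratfun_act \<sigma> x * ratfun_act \<sigma> y"
  by (cases x; cases y) (simp add: ratfun_act_Fract poly_act_mult assms)

lemma ratfun_act_zero [simp]: "bij \<sigma> \<Longrightarrow> ratfun_act \<sigma> 0 = 0"
  by (simp add: Zero_fract_def ratfun_act_Fract)

lemma ratfun_act_one [simp]: "bij \<sigma> \<Longrightarrow> ratfun_act \<sigma> 1 = 1"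
  by (simp add: One_fract_def ratfun_act_Fract)

lemma ratfun_act_id [simp]: "ratfun_act id x = x"
  by (cases x) (simp add: ratfun_act_Fract poly_act_def pushforward_id(1)[abs_def]
      flip: id_def)

lemma ratfun_act_comp:
  assumes "bij \<sigma>" "bij \<tau>"
  shows "ratfun_act (\<sigma> \<circ> \<tau>) x = ratfun_act \<sigma> (ratfun_act \<tau> x)"
proof -
  have "pushforward (\<sigma> \<circ> \<tau>) = pushforward \<sigma> \<circ> (pushforward \<tau> :: (nat \<Rightarrow>\<^sub>0 nat) \<Rightarrow> _)"
    by (auto simp: pushforward_comp)
  then show ?thesis
    using assms by (cases x) (simp add: ratfun_act_Fract bij_comp poly_act_def pushforward_comp)
qed

definition ratfun_const :: "'k::field \<Rightarrow> 'k ratfun" where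
  "ratfun_const c = Fract (Poly_Mapping.single 0 c) 1"

lemma ratfun_act_const: "bij \<sigma> \<Longrightarrow> ratfun_act \<sigma> (ratfun_const c) = ratfun_const c"
  by (simp add: ratfun_const_def ratfun_act_Fract) (simp add: poly_act_def)

lemma ratfun_act_var:
  "bij \<sigma> \<Longrightarrow> ratfun_act \<sigma> (Fract (Poly_Mapping.single (Poly_Mapping.single i 1) 1) 1) =
    Fract (Poly_Mapping.single (Poly_Mapping.single (\<sigma> i) 1) 1) 1"
  by (simp add: ratfun_act_Fract) (simp add: poly_act_def)

definition ratfun_ring :: "'k::field ratfun ring" where
  "ratfun_ring = \<lparr>carrier = UNIV, mult = (*), one = 1, zero = 0, add = (+)\<rparr>"

lemma cring_ratfun_ring: "cring (ratfun_ring :: 'k::field ratfun ring)"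
proof (rule cringI)
  show "abelian_group (ratfun_ring :: 'k ratfun ring)"
  proof (rule abelian_groupI)
    fix x :: "'k ratfun"
    show "\<exists>y\<in>carrier ratfun_ring. y \<oplus>\<^bsub>ratfun_ring\<^esub> x = \<zero>\<^bsub>ratfun_ring\<^esub>"
      by (rule bexI[of _ "- x"]) (simp_all add: ratfun_ring_def)
  qed (simp_all add: ratfun_ring_def add_ac)
  show "Group.comm_monoid (ratfun_ring :: 'k ratfun ring)"
    by (rule Group.comm_monoidI) (simp_all add: ratfun_ring_def mult_ac)
qed (simp add: ratfun_ring_def distrib_right)


section \<open>Smooth semilinear representations\<close>

text \<open>The fields \<^const>\<open>mult\<close> and \<^const>\<open>one\<close>, inherited from \<^typ>\<open>('a, 'b) module\<close>, are ignored.\<close>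

record ('a, 'b) semirep = "('a, 'b) module" +
  act :: "(nat \<Rightarrow> nat) \<Rightarrow> 'b \<Rightarrow> 'b"

locale smooth_semirep = module ratfun_ring M for M :: "('k::field ratfun, 'b) semirep" +
  assumes act_closed:
      "\<lbrakk>\<sigma> \<in> inf_sym; v \<in> carrier M\<rbrakk> \<Longrightarrow> act M \<sigma> v \<in> carrier M"
    and act_id: "v \<in> carrier M \<Longrightarrow> act M id v = v"
    and act_comp:
      "\<lbrakk>\<sigma> \<in> inf_sym; \<tau> \<in> inf_sym; v \<in> carrier M\<rbrakk> \<Longrightarrow> act M (\<sigma> \<circ> \<tau>) v = act M \<sigma> (act M \<tau> v)"
    and act_add:
      "\<lbrakk>\<sigma> \<in> inf_sym; v \<in> carrier M; w \<in> carrier M\<rbrakk> \<Longrightarrow>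
        act M \<sigma> (v \<oplus>\<^bsub>M\<^esub> w) = act M \<sigma> v \<oplus>\<^bsub>M\<^esub> act M \<sigma> w"
    and act_smult:
      "\<lbrakk>\<sigma> \<in> inf_sym; v \<in> carrier M\<rbrakk> \<Longrightarrow>
        act M \<sigma> (a \<odot>\<^bsub>M\<^esub> v) = ratfun_act \<sigma> a \<odot>\<^bsub>M\<^esub> act M \<sigma> v"
    and smooth:
      "v \<in> carrier M \<Longrightarrow> \<exists>n. \<forall>\<sigma>\<in>inf_sym_fix n. act M \<sigma> v = v"

definition semirep_hom ::
  "('k::field ratfun, 'b) semirep \<Rightarrow> ('k ratfun, 'c) semirep \<Rightarrow> ('b \<Rightarrow> 'c) set" where
  "semirep_hom M N = {f \<in> carrier M \<rightarrow> carrier N.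
     (\<forall>v\<in>carrier M. \<forall>w\<in>carrier M. f (v \<oplus>\<^bsub>M\<^esub> w) = f v \<oplus>\<^bsub>N\<^esub> f w) \<and>
     (\<forall>a. \<forall>v\<in>carrier M. f (a \<odot>\<^bsub>M\<^esub> v) = a \<odot>\<^bsub>N\<^esub> f v) \<and>
     (\<forall>\<sigma>\<in>inf_sym. \<forall>v\<in>carrier M. f (act M \<sigma> v) = act N \<sigma> (f v))}"

definition semirep_isomorphic ::
  "('k::field ratfun, 'b) semirep \<Rightarrow> ('k ratfun, 'c) semirep \<Rightarrow> bool" where
  "semirep_isomorphic M N \<longleftrightarrow> (\<exists>f\<in>semirep_hom M N. bij_betw f (carrier M) (carrier N))"

definition subrep :: "'b set \<Rightarrow> ('k::field ratfun, 'b) semirep \<Rightarrow> bool" where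
  "subrep N M \<longleftrightarrow> submodule N ratfun_ring M \<and> (\<forall>\<sigma>\<in>inf_sym. act M \<sigma> ` N \<subseteq> N)"

definition quot_semirep ::
  "('k::field ratfun, 'b) semirep \<Rightarrow> 'b set \<Rightarrow> ('k ratfun, 'b set) semirep" where
  "quot_semirep M N = \<lparr>carrier = a_rcosets\<^bsub>M\<^esub> N, mult = undefined, one = undefined,
     zero = N, add = set_add M, smult = (\<lambda>a X. \<Union>v\<in>X. N +>\<^bsub>M\<^esub> (a \<odot>\<^bsub>M\<^esub> v)),
     act = (\<lambda>\<sigma> X. \<Union>v\<in>X. N +>\<^bsub>M\<^esub> act M \<sigma> v)\<rparr>"

definition direct_sum_semirep ::
  "'j set \<Rightarrow> ('j \<Rightarrow> ('k::field ratfun, 'b) semirep) \<Rightarrow> ('k ratfun, 'j \<Rightarrow> 'b) semirep" where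
  "direct_sum_semirep J M = \<lparr>
     carrier = {x \<in> \<Pi>\<^sub>E j\<in>J. carrier (M j). finite {j \<in> J. x j \<noteq> \<zero>\<^bsub>M j\<^esub>}},
     mult = undefined, one = undefined,
     zero = (\<lambda>j\<in>J. \<zero>\<^bsub>M j\<^esub>),
     add = (\<lambda>x y. \<lambda>j\<in>J. x j \<oplus>\<^bsub>M j\<^esub> y j),
     smult = (\<lambda>a x. \<lambda>j\<in>J. a \<odot>\<^bsub>M j\<^esub> x j),
     act = (\<lambda>\<sigma> x. \<lambda>j\<in>J. act (M j) \<sigma> (x j))\<rparr>"


section \<open>The representations \<open>\<^bold>I\<^sup>r\<close>\<close>

text \<open>The base change to \<open>\<^bold>K\<close> of the \<open>\<^bold>k\<close>-space with basis \<open>e\<^sub>S\<close> is modelled by finitely supported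
  \<open>\<^bold>K\<close>-valued functions on the \<open>r\<close>-element sets \<open>S\<close>; that this is the tensor product \<open>\<^bold>K \<otimes> \<^bold>V\<^sup>r\<close> over \<open>\<^bold>k\<close>
  is the content of \<open>I_rep_tensor\<close> and \<open>I_rep_universal\<close> below.\<close>

definition r_subsets :: "nat \<Rightarrow> nat set set" where
  "r_subsets r = {S. finite S \<and> card S = r}"

definition I_rep :: "nat \<Rightarrow> ('k::field ratfun, nat set \<Rightarrow>\<^sub>0 'k ratfun) semirep" where
  "I_rep r = \<lparr>carrier = {f. Poly_Mapping.keys f \<subseteq> r_subsets r}, mult = undefined, one = undefined,
     zero = 0, add = (+), smult = (\<lambda>a. Poly_Mapping.map ((*) a)),
     act = (\<lambda>\<sigma> f. pushforward ((`) \<sigma>) (Poly_Mapping.map (ratfun_act \<sigma>) f))\<rparr>"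

definition V_space :: "nat \<Rightarrow> (nat set \<Rightarrow>\<^sub>0 'k::field) set" where
  "V_space r = {v. Poly_Mapping.keys v \<subseteq> r_subsets r}"

definition V_act :: "(nat \<Rightarrow> nat) \<Rightarrow> (nat set \<Rightarrow>\<^sub>0 'k::field) \<Rightarrow> nat set \<Rightarrow>\<^sub>0 'k" where
  "V_act \<sigma> = pushforward ((`) \<sigma>)"

definition pure_tensor :: "'k::field ratfun \<Rightarrow> (nat set \<Rightarrow>\<^sub>0 'k) \<Rightarrow> nat set \<Rightarrow>\<^sub>0 'k ratfun" where
  "pure_tensor a v = Poly_Mapping.map (\<lambda>c. a * ratfun_const c) v"


lemma inf_sym_image_r_subsets: "\<sigma> \<in> inf_sym \<Longrightarrow> S \<in> r_subsets r \<Longrightarrow> \<sigma> ` S \<in> r_subsets r"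
  by (metis (no_types, lifting) bij_is_inj card_image finite_imageI inf_sym_bij inj_on_subset
      mem_Collect_eq r_subsets_def subset_UNIV)

lemma keys_pushforward: "Poly_Mapping.keys (pushforward f p) \<subseteq> f ` Poly_Mapping.keys p"
  unfolding pushforward_def
  by (rule order_trans[OF keys_sum]) (auto split: if_splits)

lemma map_single_ratfun:
  "g 0 = 0 \<Longrightarrow> Poly_Mapping.map g (Poly_Mapping.single x c) = Poly_Mapping.single x (g c)"
  by (rule poly_mapping_eqI) (auto simp: Poly_Mapping.map.rep_eq lookup_single when_def)

lemma map_add_additive:
  assumes "g 0 = 0" "\<And>x y. g (x + y) = g x + g y"
  shows "Poly_Mapping.map g (p + q) = Poly_Mapping.map g p + Poly_Mapping.map g q"
  by (rule poly_mapping_eqI) (auto simp: Poly_Mapping.map.rep_eq lookup_add when_def assms simp flip: assms(2))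

lemma map_zero [simp]: "Poly_Mapping.map g 0 = 0"
  by (rule poly_mapping_eqI) (simp add: Poly_Mapping.map.rep_eq)

lemma keys_map_subset: "Poly_Mapping.keys (Poly_Mapping.map g p) \<subseteq> Poly_Mapping.keys p"
  by (auto simp: in_keys_iff Poly_Mapping.map.rep_eq when_def)

lemma ratfun_const_zero [simp]: "ratfun_const 0 = 0"
  by (simp add: ratfun_const_def Zero_fract_def)

lemma ratfun_const_one [simp]: "ratfun_const 1 = 1"
  by (simp add: ratfun_const_def One_fract_def)

lemma ratfun_const_add: "ratfun_const (c + d) = ratfun_const c + ratfun_const d"
  by (simp add: ratfun_const_def single_add)

lemma ratfun_const_mult: "ratfun_const (c * d) = ratfun_const c * ratfun_const d"
  by (simp add: ratfun_const_def mult_single)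

lemma ratfun_act_smooth: "\<exists>n. \<forall>\<sigma>\<in>inf_sym_fix n. ratfun_act \<sigma> x = x"
proof -
  have mono: "\<exists>n. \<forall>\<sigma>\<in>inf_sym_fix n. pushforward \<sigma> m = m" for m :: "nat \<Rightarrow>\<^sub>0 nat"
  proof -
    obtain n where n: "\<forall>i\<in>Poly_Mapping.keys m. i < n"
      using finite_nat_set_iff_bounded[of "Poly_Mapping.keys m"] by auto
    have "pushforward \<sigma> m = m" if "\<sigma> \<in> inf_sym_fix n" for \<sigma>
    proof -
      have "pushforward \<sigma> m = pushforward id m"
        by (rule pushforward_cong) (use that n in \<open>auto simp: inf_sym_fix_def\<close>)
      then show ?thesis by simp
    qed
    then show ?thesis by blast
  qed
  have poly: "\<exists>n. \<forall>\<sigma>\<in>inf_sym_fix n. poly_act \<sigma> p = p" for p :: "(nat \<Rightarrow>\<^sub>0 nat) \<Rightarrow>\<^sub>0 'a"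
  proof (induction p rule: poly_mapping_additive_induct)
    case (single m c)
    obtain n where "\<forall>\<sigma>\<in>inf_sym_fix n. pushforward \<sigma> m = m"
      using mono by blast
    then show ?case
      by (intro exI[of _ n]) (simp add: poly_act_def)
  next
    case (add p q)
    then obtain m n where "\<forall>\<sigma>\<in>inf_sym_fix m. poly_act \<sigma> p = p" "\<forall>\<sigma>\<in>inf_sym_fix n. poly_act \<sigma> q = q"
      by blast
    then show ?case
      by (intro exI[of _ "max m n"]) (auto simp: inf_sym_fix_def poly_act_add)
  qed simp
  obtain a b where x: "x = Fract a b"
    by (cases x)
  obtain m n where "\<forall>\<sigma>\<in>inf_sym_fix m. poly_act \<sigma> a = a" "\<forall>\<sigma>\<in>inf_sym_fix n. poly_act \<sigma> b = b"
    using poly[of a] poly[of b] by blast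
  then show ?thesis
    by (intro exI[of _ "max m n"])
       (auto simp: x inf_sym_fix_def ratfun_act_Fract inf_sym_bij)
qed

lemma smooth_semirep_I_rep: "smooth_semirep (I_rep r :: ('k::field ratfun, _) semirep)"
proof -
  let ?I = "I_rep r :: ('k ratfun, _) semirep"
  let ?C = "carrier ?I"
  have add_closed: "x + y \<in> ?C" if "x \<in> ?C" "y \<in> ?C" for x y
    using that Poly_Mapping.keys_add[of x y] by (auto simp: I_rep_def)
  have ab: "abelian_group ?I"
  proof (rule abelian_groupI)
    fix x :: "nat set \<Rightarrow>\<^sub>0 'k ratfun"
    assume "x \<in> ?C"
    then show "\<exists>y\<in>?C. y \<oplus>\<^bsub>?I\<^esub> x = \<zero>\<^bsub>?I\<^esub>"
      by (intro bexI[of _ "- x"]) (auto simp: I_rep_def)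
  qed (use add_closed in \<open>simp_all add: I_rep_def add_ac\<close>)
  have closed: "Poly_Mapping.map g x \<in> ?C" if "x \<in> ?C" for g x
    using that keys_map_subset[of g x] by (auto simp: I_rep_def)
  have mod: "module ratfun_ring ?I"
  proof (rule moduleI[OF cring_ratfun_ring ab])
    fix a b :: "'k ratfun" and x y :: "nat set \<Rightarrow>\<^sub>0 'k ratfun"
    assume "x \<in> ?C"
    then show "a \<odot>\<^bsub>?I\<^esub> x \<in> ?C"
      using closed by (simp add: I_rep_def)
    show "(a \<oplus>\<^bsub>ratfun_ring\<^esub> b) \<odot>\<^bsub>?I\<^esub> x = a \<odot>\<^bsub>?I\<^esub> x \<oplus>\<^bsub>?I\<^esub> b \<odot>\<^bsub>?I\<^esub> x"
      by (rule poly_mapping_eqI)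
         (simp add: I_rep_def ratfun_ring_def Poly_Mapping.map.rep_eq lookup_add when_def distrib_right)
    show "a \<odot>\<^bsub>?I\<^esub> (x \<oplus>\<^bsub>?I\<^esub> y) = a \<odot>\<^bsub>?I\<^esub> x \<oplus>\<^bsub>?I\<^esub> a \<odot>\<^bsub>?I\<^esub> y"
      by (simp add: I_rep_def map_add_additive distrib_left)
    show "(a \<otimes>\<^bsub>ratfun_ring\<^esub> b) \<odot>\<^bsub>?I\<^esub> x = a \<odot>\<^bsub>?I\<^esub> (b \<odot>\<^bsub>?I\<^esub> x)"
      by (rule poly_mapping_eqI)
         (simp add: I_rep_def ratfun_ring_def Poly_Mapping.map.rep_eq when_def mult.assoc)
    show "\<one>\<^bsub>ratfun_ring\<^esub> \<odot>\<^bsub>?I\<^esub> x = x"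
      by (rule poly_mapping_eqI)
         (simp add: I_rep_def ratfun_ring_def Poly_Mapping.map.rep_eq when_def)
  qed
  show ?thesis
  proof (rule smooth_semirep.intro[OF mod], rule smooth_semirep_axioms.intro)
    fix \<sigma> and x :: "nat set \<Rightarrow>\<^sub>0 'k ratfun" assume \<sigma>: "\<sigma> \<in> inf_sym" and x: "x \<in> ?C"
    have "Poly_Mapping.keys (act ?I \<sigma> x) \<subseteq> (`) \<sigma> ` Poly_Mapping.keys x"
      unfolding I_rep_def semirep.select_convs
      by (rule order_trans[OF keys_pushforward image_mono[OF keys_map_subset]])
    also have "\<dots> \<subseteq> r_subsets r"
      using x inf_sym_image_r_subsets[OF \<sigma>] by (auto simp: I_rep_def)
    finally show "act ?I \<sigma> x \<in> ?C"
      by (simp add: I_rep_def)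
    note \<sigma>' = inf_sym_bij[OF \<sigma>]
    show "act ?I \<sigma> (a \<odot>\<^bsub>?I\<^esub> x) = ratfun_act \<sigma> a \<odot>\<^bsub>?I\<^esub> act ?I \<sigma> x" for a
      by (induction x rule: poly_mapping_additive_induct)
         (simp_all add: I_rep_def map_single_ratfun map_add_additive pushforward_add
            distrib_left ratfun_act_add ratfun_act_mult \<sigma>')
    show "act ?I \<sigma> (x \<oplus>\<^bsub>?I\<^esub> y) = act ?I \<sigma> x \<oplus>\<^bsub>?I\<^esub> act ?I \<sigma> y" for y
      by (simp add: I_rep_def map_add_additive pushforward_add ratfun_act_add \<sigma>')
    fix \<tau> assume "\<tau> \<in> inf_sym"
    note \<tau>' = inf_sym_bij[OF this]
    show "act ?I (\<sigma> \<circ> \<tau>) x = act ?I \<sigma> (act ?I \<tau> x)"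
      using \<sigma>' \<tau>'
      by (induction x rule: poly_mapping_additive_induct)
         (simp_all add: I_rep_def map_single_ratfun map_add_additive pushforward_add
            ratfun_act_add ratfun_act_comp bij_comp image_comp)
  next
    fix x :: "nat set \<Rightarrow>\<^sub>0 'k ratfun" assume x: "x \<in> ?C"
    have "Poly_Mapping.map (ratfun_act id) x = x"
      by (rule poly_mapping_eqI) (simp only: Poly_Mapping.map.rep_eq ratfun_act_id when_def, simp)
    moreover have "(`) id = (id :: nat set \<Rightarrow> _)"
      by auto
    ultimately show "act ?I id x = x"
      by (simp only: I_rep_def semirep.select_convs pushforward_id)
    have "\<exists>n. \<forall>\<sigma>\<in>inf_sym_fix n. act ?I \<sigma> x = x" if "Poly_Mapping.keys x \<subseteq> r_subsets r"
    proof -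
      have "\<exists>n. \<forall>\<sigma>\<in>inf_sym_fix n. act ?I \<sigma> (\<Sum>S\<in>A. Poly_Mapping.single S (Poly_Mapping.lookup x S)) =
          (\<Sum>S\<in>A. Poly_Mapping.single S (Poly_Mapping.lookup x S))"
        if "finite A" "A \<subseteq> r_subsets r" for A
        using that
      proof (induction A)
        case empty
        then show ?case by (simp add: I_rep_def)
      next
        case (insert S A)
        let ?t = "\<Sum>S\<in>A. Poly_Mapping.single S (Poly_Mapping.lookup x S)"
        obtain m where m: "\<forall>\<sigma>\<in>inf_sym_fix m. act ?I \<sigma> ?t = ?t"
          using insert by auto
        obtain n where n: "\<forall>\<sigma>\<in>inf_sym_fix n. ratfun_act \<sigma> (Poly_Mapping.lookup x S) = Poly_Mapping.lookup x S"
          using ratfun_act_smooth by blast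
        obtain k where k: "\<forall>i\<in>S. i < k"
          using insert.prems finite_nat_set_iff_bounded[of S] by (auto simp: r_subsets_def)
        have "act ?I \<sigma> (\<Sum>S\<in>insert S A. Poly_Mapping.single S (Poly_Mapping.lookup x S)) =
            (\<Sum>S\<in>insert S A. Poly_Mapping.single S (Poly_Mapping.lookup x S))"
          if "\<sigma> \<in> inf_sym_fix (max m (max n k))" for \<sigma>
        proof -
          have "\<sigma> ` S = id ` S"
            by (rule image_cong) (use that k in \<open>auto simp: inf_sym_fix_def\<close>)
          then have "\<sigma> \<in> inf_sym_fix m" "\<sigma> \<in> inf_sym_fix n" "\<sigma> ` S = S" "bij \<sigma>"
            using that by (auto simp: inf_sym_fix_def inf_sym_bij)
          with m n insert.hyps show ?thesis
            by (simp add: I_rep_def map_add_additive map_single_ratfun pushforward_add ratfun_act_add)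
        qed
        then show ?case by blast
      qed
      from this[of "Poly_Mapping.keys x"] that show ?thesis
        by (simp add: poly_mapping_sum_monomials)
    qed
    with x show "\<exists>n. \<forall>\<sigma>\<in>inf_sym_fix n. act ?I \<sigma> x = x"
      by (simp add: I_rep_def)
  qed
qed

lemma I_rep_tensor:
  "v \<in> V_space r \<Longrightarrow> pure_tensor a v \<in> carrier (I_rep r)"
  "pure_tensor (a + b) v = pure_tensor a v \<oplus>\<^bsub>I_rep r\<^esub> pure_tensor b v"
  "pure_tensor a (v + w) = pure_tensor a v \<oplus>\<^bsub>I_rep r\<^esub> pure_tensor a w"
  "pure_tensor (a * ratfun_const c) v = pure_tensor a (Poly_Mapping.map ((*) c) v)"
  "b \<odot>\<^bsub>I_rep r\<^esub> pure_tensor a v = pure_tensor (b * a) v"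
  "\<sigma> \<in> inf_sym \<Longrightarrow>
     act (I_rep r) \<sigma> (pure_tensor a v) = pure_tensor (ratfun_act \<sigma> a) (V_act \<sigma> v)"
proof -
  show "v \<in> V_space r \<Longrightarrow> pure_tensor a v \<in> carrier (I_rep r)"
    using keys_map_subset by (fastforce simp: V_space_def I_rep_def pure_tensor_def)
  show "pure_tensor (a + b) v = pure_tensor a v \<oplus>\<^bsub>I_rep r\<^esub> pure_tensor b v"
    by (rule poly_mapping_eqI)
       (simp add: I_rep_def pure_tensor_def Poly_Mapping.map.rep_eq lookup_add when_def distrib_right)
  show "pure_tensor a (v + w) = pure_tensor a v \<oplus>\<^bsub>I_rep r\<^esub> pure_tensor a w"
    by (simp add: I_rep_def pure_tensor_def map_add_additive ratfun_const_add distrib_left)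
  show "pure_tensor (a * ratfun_const c) v = pure_tensor a (Poly_Mapping.map ((*) c) v)"
    by (rule poly_mapping_eqI)
       (auto simp: pure_tensor_def Poly_Mapping.map.rep_eq when_def ratfun_const_mult)
  show "b \<odot>\<^bsub>I_rep r\<^esub> pure_tensor a v = pure_tensor (b * a) v"
    by (rule poly_mapping_eqI)
       (auto simp: I_rep_def pure_tensor_def Poly_Mapping.map.rep_eq when_def)
  assume "\<sigma> \<in> inf_sym"
  then have \<sigma>: "bij \<sigma>"
    by (rule inf_sym_bij)
  show "act (I_rep r) \<sigma> (pure_tensor a v) = pure_tensor (ratfun_act \<sigma> a) (V_act \<sigma> v)"
    unfolding pure_tensor_def V_act_def
    by (induction v rule: poly_mapping_additive_induct)
       (simp_all add: I_rep_def map_single_ratfun map_add_additive pushforward_add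
          ratfun_const_add distrib_left ratfun_act_add ratfun_act_mult ratfun_act_const \<sigma>)
qed

lemma I_rep_universal:
  fixes \<beta> :: "'k::field ratfun \<Rightarrow> (nat set \<Rightarrow>\<^sub>0 'k) \<Rightarrow> 'c::ab_group_add"
  assumes add_left: "\<And>a b v. v \<in> V_space r \<Longrightarrow> \<beta> (a + b) v = \<beta> a v + \<beta> b v"
    and add_right: "\<And>a v w. v \<in> V_space r \<Longrightarrow> w \<in> V_space r \<Longrightarrow> \<beta> a (v + w) = \<beta> a v + \<beta> a w"
    and balanced: "\<And>a c v. v \<in> V_space r \<Longrightarrow>
      \<beta> (a * ratfun_const c) v = \<beta> a (Poly_Mapping.map ((*) c) v)"
  shows "\<exists>!\<phi>. \<phi> \<in> extensional (carrier (I_rep r)) \<and>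
    (\<forall>x\<in>carrier (I_rep r). \<forall>y\<in>carrier (I_rep r). \<phi> (x \<oplus>\<^bsub>I_rep r\<^esub> y) = \<phi> x + \<phi> y) \<and>
    (\<forall>a. \<forall>v\<in>V_space r. \<phi> (pure_tensor a v) = \<beta> a v)"
proof -
  let ?C = "carrier (I_rep r :: ('k ratfun, _) semirep)"
  let ?e = "\<lambda>S. Poly_Mapping.single S (1::'k)"
  define \<psi> where "\<psi> x = (\<Sum>S\<in>Poly_Mapping.keys x. \<beta> (Poly_Mapping.lookup x S) (?e S))"
    for x :: "nat set \<Rightarrow>\<^sub>0 'k ratfun"
  have C: "?C = {x. Poly_Mapping.keys x \<subseteq> r_subsets r}" and plus: "x \<oplus>\<^bsub>I_rep r\<^esub> y = x + y"
    for x y :: "nat set \<Rightarrow>\<^sub>0 'k ratfun"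
    by (simp_all add: I_rep_def)
  have e: "?e S \<in> V_space r" if "S \<in> r_subsets r" for S
    using that by (simp add: V_space_def)
  have \<beta>0: "\<beta> 0 v = 0" if "v \<in> V_space r" for v
    using add_left[of v 0 0] that by simp
  have \<beta>0': "\<beta> a 0 = 0" for a
    using add_right[of 0 0 a] by (simp add: V_space_def)
  have \<psi>_super: "\<psi> x = (\<Sum>S\<in>A. \<beta> (Poly_Mapping.lookup x S) (?e S))"
    if "finite A" "Poly_Mapping.keys x \<subseteq> A" "A \<subseteq> r_subsets r" for x A
    unfolding \<psi>_def
    by (rule sum.mono_neutral_left) (use that e \<beta>0 in \<open>auto simp: in_keys_iff\<close>)
  have \<psi>_add: "\<psi> (x + y) = \<psi> x + \<psi> y" if "x \<in> ?C" "y \<in> ?C" for x y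
  proof -
    let ?A = "Poly_Mapping.keys x \<union> Poly_Mapping.keys y"
    have A: "finite ?A" "?A \<subseteq> r_subsets r"
      using that by (auto simp: C)
    have "\<psi> (x + y) = (\<Sum>S\<in>?A. \<beta> (Poly_Mapping.lookup (x + y) S) (?e S))"
      by (rule \<psi>_super) (use A Poly_Mapping.keys_add[of x y] in simp_all)
    also have "\<dots> = (\<Sum>S\<in>?A. \<beta> (Poly_Mapping.lookup x S) (?e S) +
        \<beta> (Poly_Mapping.lookup y S) (?e S))"
      by (rule sum.cong) (use A e in \<open>auto simp: lookup_add add_left\<close>)
    also have "\<dots> = \<psi> x + \<psi> y"
      using A by (simp add: sum.distrib \<psi>_super[of ?A])
    finally show ?thesis .
  qed
  have single_tensor: "pure_tensor a (Poly_Mapping.single S c) =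
      Poly_Mapping.single S (a * ratfun_const c)" for a :: "'k ratfun" and S c
    by (simp add: pure_tensor_def map_single_ratfun)
  have \<psi>_tensor: "\<psi> (pure_tensor a v) = \<beta> a v" if "v \<in> V_space r" for a v
  proof -
    have *: "\<beta> a v = (\<Sum>S\<in>A. \<beta> a (Poly_Mapping.single S (Poly_Mapping.lookup v S)))"
      if "v = (\<Sum>S\<in>A. Poly_Mapping.single S (Poly_Mapping.lookup v S))"
         "finite A" "A \<subseteq> r_subsets r" for A
    proof -
      have "\<beta> a (\<Sum>S\<in>A. Poly_Mapping.single S (Poly_Mapping.lookup v S)) =
          (\<Sum>S\<in>A. \<beta> a (Poly_Mapping.single S (Poly_Mapping.lookup v S))) \<and>
          (\<Sum>S\<in>A. Poly_Mapping.single S (Poly_Mapping.lookup v S)) \<in> V_space r"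
        using that(2,3)
      proof (induction A)
        case empty
        then show ?case by (simp add: \<beta>0' V_space_def)
      next
        case (insert S A)
        have 1: "Poly_Mapping.single S (Poly_Mapping.lookup v S) \<in> V_space r"
          using insert.prems by (auto simp: V_space_def)
        moreover have "x + y \<in> V_space r" if "x \<in> V_space r" "y \<in> V_space r"
          for x y :: "nat set \<Rightarrow>\<^sub>0 'k"
          using that Poly_Mapping.keys_add[of x y] by (auto simp: V_space_def)
        ultimately show ?case
          using insert by (simp add: add_right)
      qed
      then show ?thesis
        using that(1) by simp
    qed
    have "\<beta> a v = (\<Sum>S\<in>Poly_Mapping.keys v. \<beta> a (Poly_Mapping.single S (Poly_Mapping.lookup v S)))"
      by (rule *) (use that in \<open>simp_all add: poly_mapping_sum_monomials V_space_def\<close>)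
    also have "\<dots> = (\<Sum>S\<in>Poly_Mapping.keys v. \<beta> (Poly_Mapping.lookup (pure_tensor a v) S) (?e S))"
    proof (rule sum.cong)
      fix S assume S: "S \<in> Poly_Mapping.keys v"
      then have "S \<in> r_subsets r"
        using that by (auto simp: V_space_def)
      with S show "\<beta> a (Poly_Mapping.single S (Poly_Mapping.lookup v S)) =
          \<beta> (Poly_Mapping.lookup (pure_tensor a v) S) (?e S)"
        by (simp add: pure_tensor_def Poly_Mapping.map.rep_eq in_keys_iff balanced e map_single_ratfun)
    qed simp
    also have "\<dots> = \<psi> (pure_tensor a v)"
      by (rule \<psi>_super[symmetric])
         (use that in \<open>simp_all add: V_space_def pure_tensor_def keys_map_subset\<close>)
    finally show ?thesis ..
  qed
  show ?thesis
  proof (rule ex1I[of _ "restrict \<psi> ?C"])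
    have "x + y \<in> ?C" if "x \<in> ?C" "y \<in> ?C" for x y
      using that Poly_Mapping.keys_add[of x y] by (auto simp: C)
    then show "restrict \<psi> ?C \<in> extensional ?C \<and>
      (\<forall>x\<in>?C. \<forall>y\<in>?C. restrict \<psi> ?C (x \<oplus>\<^bsub>I_rep r\<^esub> y) = restrict \<psi> ?C x + restrict \<psi> ?C y) \<and>
      (\<forall>a. \<forall>v\<in>V_space r. restrict \<psi> ?C (pure_tensor a v) = \<beta> a v)"
      using \<psi>_add \<psi>_tensor by (simp add: plus I_rep_tensor(1))
  next
    fix \<phi> assume \<phi>: "\<phi> \<in> extensional ?C \<and>
      (\<forall>x\<in>?C. \<forall>y\<in>?C. \<phi> (x \<oplus>\<^bsub>I_rep r\<^esub> y) = \<phi> x + \<phi> y) \<and>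
      (\<forall>a. \<forall>v\<in>V_space r. \<phi> (pure_tensor a v) = \<beta> a v)"
    have \<phi>_single: "\<phi> (Poly_Mapping.single S c) = \<beta> c (?e S)" if "S \<in> r_subsets r" for S c
      using \<phi> e[OF that] single_tensor[of c S 1] by (metis mult.right_neutral ratfun_const_one)
    have 0: "0 \<in> ?C"
      by (simp add: C)
    have \<phi>_plus: "\<phi> (x + y) = \<phi> x + \<phi> y" if "x \<in> ?C" "y \<in> ?C" for x y
      using \<phi> that by (simp add: plus)
    from this[OF 0 0] have \<phi>0: "\<phi> 0 = 0"
      by simp
    have "\<phi> x = \<psi> x" if "x \<in> ?C" for x
    proof -
      have *: "\<phi> (\<Sum>S\<in>A. Poly_Mapping.single S (Poly_Mapping.lookup x S)) =
          (\<Sum>S\<in>A. \<beta> (Poly_Mapping.lookup x S) (?e S)) \<and>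
          (\<Sum>S\<in>A. Poly_Mapping.single S (Poly_Mapping.lookup x S)) \<in> ?C"
        if "finite A" "A \<subseteq> r_subsets r" for A
        using that
      proof (induction A)
        case empty
        then show ?case using \<phi>0 0 by simp
      next
        case (insert S A)
        let ?s = "Poly_Mapping.single S (Poly_Mapping.lookup x S)"
        let ?t = "\<Sum>S\<in>A. Poly_Mapping.single S (Poly_Mapping.lookup x S)"
        have 1: "?s \<in> ?C"
          using insert.prems by (auto simp: C)
        have 2: "?t \<in> ?C"
          using insert by auto
        have 3: "?s + ?t \<in> ?C"
          using 1 2 Poly_Mapping.keys_add[of ?s ?t] by (auto simp: C)
        have "\<phi> (?s + ?t) = \<phi> ?s + \<phi> ?t"
          by (rule \<phi>_plus[OF 1 2])
        with 3 insert show ?case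
          by (simp add: \<phi>_single)
      qed
      show ?thesis
        using *[of "Poly_Mapping.keys x"] that
        by (simp add: C \<psi>_def poly_mapping_sum_monomials)
    qed
    then show "\<phi> = restrict \<psi> ?C"
      using \<phi> by (auto simp: extensional_def)
  qed
qed


section \<open>Standard and semi-standard objects\<close>

text \<open>Since \<open>\<^bold>I\<^sup>r \<noteq> 0\<close>, the index set of a direct sum isomorphic to \<open>M\<close> embeds into the carrier of \<open>M\<close>,
  so restricting to index sets in the type of elements of \<open>M\<close> is harmless; see \<open>standardI\<close>.\<close>

definition standard :: "('k::field ratfun, 'b) semirep \<Rightarrow> bool" where
  "standard M \<longleftrightarrow>
    (\<exists>(J :: 'b set) d. semirep_isomorphic M (direct_sum_semirep J (\<lambda>j. I_rep (d j))))"

lemma standardI: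
  fixes M :: "('k::field ratfun, 'b) semirep" and J :: "'j set"
  assumes "semirep_isomorphic M (direct_sum_semirep J (\<lambda>j. I_rep (d j)))"
  shows "standard M"
proof -
  let ?D = "direct_sum_semirep J (\<lambda>j. I_rep (d j)) :: ('k ratfun, _) semirep"
  obtain f where f: "f \<in> semirep_hom M ?D" "bij_betw f (carrier M) (carrier ?D)"
    using assms by (auto simp: semirep_isomorphic_def)
  define e where "e j = (\<lambda>i\<in>J. if i = j then Poly_Mapping.single {..<d j} (1 :: 'k ratfun) else 0)" for j
  have e: "e j \<in> carrier ?D" if "j \<in> J" for j
    using that by (auto simp: direct_sum_semirep_def e_def I_rep_def r_subsets_def
        intro: finite_subset[of _ "{j}"])
  have "inj_on e J"
  proof (rule inj_onI)
    fix i j assume "i \<in> J" "j \<in> J" "e i = e j"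
    then have "e i i = e j i"
      by simp
    with \<open>i \<in> J\<close> show "i = j"
      by (auto simp: e_def split: if_splits dest: arg_cong[of _ _ Poly_Mapping.keys])
  qed
  define h where "h = inv_into (carrier M) f \<circ> e"
  have h: "inj_on h J"
    unfolding h_def
    by (rule comp_inj_on[OF \<open>inj_on e J\<close>])
       (use e f(2) in \<open>auto simp: bij_betw_def intro!: inj_on_inv_into\<close>)
  define g where "g = inv_into J h"
  have gh: "g (h j) = j" if "j \<in> J" for j
    using h that by (simp add: g_def)
  let ?D' = "direct_sum_semirep (h ` J) (\<lambda>j. I_rep (d (g j))) :: ('k ratfun, _) semirep"
  define t where "t x = (\<lambda>i\<in>h ` J. x (g i))" for x :: "'j \<Rightarrow> nat set \<Rightarrow>\<^sub>0 'k ratfun"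
  have fin: "finite {i \<in> h ` J. P (g i)} \<longleftrightarrow> finite {j \<in> J. P j}" for P
  proof -
    have "{i \<in> h ` J. P (g i)} = h ` {j \<in> J. P j}"
      by (auto simp: gh)
    then show ?thesis
      using h by (metis (no_types, lifting) finite_image_iff inj_on_subset mem_Collect_eq subsetI)
  qed
  have t_closed: "t x \<in> carrier ?D'" if "x \<in> carrier ?D" for x
  proof -
    have "{i \<in> h ` J. t x i \<noteq> 0} = {i \<in> h ` J. x (g i) \<noteq> 0}"
      by (auto simp: t_def)
    then show ?thesis
      using that fin[of "\<lambda>j. x j \<noteq> 0"]
      by (auto simp: direct_sum_semirep_def I_rep_def t_def gh PiE_iff)
  qed
  have "bij_betw t (carrier ?D) (carrier ?D')"
  proof (rule bij_betw_byWitness[where f' = "\<lambda>y. \<lambda>j\<in>J. y (h j)"])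
    show "\<forall>x\<in>carrier ?D. (\<lambda>j\<in>J. t x (h j)) = x"
      by (auto simp: direct_sum_semirep_def t_def gh PiE_iff extensional_def)
    show "\<forall>y\<in>carrier ?D'. t (\<lambda>j\<in>J. y (h j)) = y"
      by (auto simp: direct_sum_semirep_def t_def gh PiE_iff extensional_def fun_eq_iff)
    show "t ` carrier ?D \<subseteq> carrier ?D'"
      using t_closed by auto
    show "(\<lambda>y. \<lambda>j\<in>J. y (h j)) ` carrier ?D' \<subseteq> carrier ?D"
    proof clarify
      fix y assume y: "y \<in> carrier ?D'"
      have "{j \<in> J. (\<lambda>j\<in>J. y (h j)) j \<noteq> 0} = {j \<in> J. y (h j) \<noteq> 0}"
        by auto
      moreover have "{i \<in> h ` J. y (h (g i)) \<noteq> 0} = {i \<in> h ` J. y i \<noteq> 0}"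
        by (auto simp: gh)
      ultimately show "(\<lambda>j\<in>J. y (h j)) \<in> carrier ?D"
        using y fin[of "\<lambda>j. y (h j) \<noteq> 0"]
        by (auto simp: direct_sum_semirep_def I_rep_def gh PiE_iff)
    qed
  qed
  with f(2) have "bij_betw (t \<circ> f) (carrier M) (carrier ?D')"
    by (rule bij_betw_trans)
  moreover have "t \<circ> f \<in> semirep_hom M ?D'"
    using f(1) t_closed
    by (auto simp: semirep_hom_def direct_sum_semirep_def t_def gh Pi_iff fun_eq_iff)
  ultimately show ?thesis
    unfolding standard_def semirep_isomorphic_def
    by (intro exI[of _ "h ` J"] exI[of _ "\<lambda>i. d (g i)"] bexI[of _ "t \<circ> f"])
qed

definition semi_standard :: "('k::field ratfun, 'b) semirep \<Rightarrow> bool" where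
  "semi_standard M \<longleftrightarrow> (\<exists>n F. F 0 = {\<zero>\<^bsub>M\<^esub>} \<and> F n = carrier M \<and> (\<forall>i\<le>n. subrep (F i) M) \<and>
     (\<forall>i<n. F i \<subseteq> F (Suc i) \<and> standard (quot_semirep (M\<lparr>carrier := F (Suc i)\<rparr>) (F i))))"

end

theory Submission
  imports Defs "HOL-Computational_Algebra.Formal_Laurent_Series"
begin

text \<open>By induction on the filtration it suffices to split an extension \<open>M\<close> of a standard object by a
  standard object \<open>N\<close>. The constant coefficient of the Laurent expansion in \<open>\<xi>\<^sub>w\<close> is an additive projection
  of \<open>\<^bold>K\<close> onto the rational functions not involving \<open>\<xi>\<^sub>w\<close>; together with killing all \<open>e\<^sub>S\<close> with \<open>w \<in> S\<close> it
  yields a projection \<open>L\<^sub>w\<close> of \<open>N\<close> that commutes with all permutations fixing \<open>w\<close>. Suppose that \<open>m \<in> M\<close> is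
  fixed by the permutations fixing \<open>0, \<dots>, n\<close> pointwise and that its class modulo \<open>N\<close> is already fixed by
  those fixing \<open>0, \<dots>, n - 1\<close>. For \<open>w = n + 1\<close> and the transposition \<open>\<tau> = (n w)\<close>, the vector
  \<open>m + L\<^sub>w (\<tau> m - m)\<close> is then fixed by the latter group. Iterating this, and averaging over a finite
  symmetric group with an element of trace \<open>1\<close>, lifts the generators of the quotient to vectors with the same
  stabilizers, which defines a section.\<close>

section \<open>Eliminating a variable from a rational function\<close>

text \<open>For a lift m of a generator of the quotient, the differences \<sigma> m - m form a
  cocycle of the stabilizer with values in \<open>N\<close>. The obstacle is that this stabilizer is
  infinite, so averaging over it makes no sense. A point w that m does not involve takes over that
  role: with x = \<tau> m - m, every \<sigma> that fixes w and 0, ..., n - 1 satisfies \<sigma> m -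
  m = x - \<sigma> x, because \<tau> has traded n for w in m. But x itself involves w, and w must be
  removed without spoiling this identity. An additive map that commutes with those \<sigma> and
  fixes the vectors free of w does this; linearity over the field is not asked of it. Substituting a
  value for \<open>\<xi>\<^sub>w\<close> would fail at poles, whereas a Laurent expansion always has
  a constant coefficient. The generator indexed by S is fixed by the setwise stabilizer of S, an
  extension of a finite symmetric group by the pointwise stabilizer. Only that finite quotient is
  averaged over, and an element of trace 1 replaces division by its order, which may vanish in the
  field.\<close>

definition fls_map :: "('a::zero \<Rightarrow> 'b::zero) \<Rightarrow> 'a fls \<Rightarrow> 'b fls" where
  "fls_map h F = Abs_fls (\<lambda>n. h (fls_nth F n))"

lemma fls_map_nth [simp]: "h 0 = 0 \<Longrightarrow> fls_nth (fls_map h F) n = h (fls_nth F n)"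
  unfolding fls_map_def
  by (rule nth_Abs_fls_lower_bound[of "fls_subdegree F"]) (simp add: fls_eq0_below_subdegree)

lemma fls_map_add:
  fixes h :: "'a::field \<Rightarrow> 'a"
  assumes "h 0 = 0" "\<And>x y. h (x + y) = h x + h y"
  shows "fls_map h (F + G) = fls_map h F + fls_map h G"
  by (rule fls_eqI) (simp add: assms)

lemma fls_map_eq_0_iff:
  assumes "\<And>x. h x = 0 \<longleftrightarrow> x = 0"
  shows "fls_map h F = 0 \<longleftrightarrow> F = 0"
  by (simp add: fls_eq_iff assms)

text \<open>The product formula sums over a range whose ends are the subdegrees of the factors.
  Since \<open>h\<close> vanishes only at 0, it preserves subdegrees, so both sides sum over the
  same range.\<close>

lemma fls_map_mult:
  fixes h :: "'a::field \<Rightarrow> 'a"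
  assumes h0: "\<And>x. h x = 0 \<longleftrightarrow> x = 0"
    and add: "\<And>x y. h (x + y) = h x + h y" and mult: "\<And>x y. h (x * y) = h x * h y"
  shows "fls_map h (F * G) = fls_map h F * fls_map h G"
proof -
  have sd: "fls_subdegree (fls_map h H) = fls_subdegree H" for H
  proof (cases "H = 0")
    case False
    then show ?thesis
      by (intro fls_subdegree_eqI) (simp_all add: h0 fls_eq0_below_subdegree)
  next
    case True
    then have "fls_map h H = 0"
      by (simp add: fls_map_eq_0_iff h0)
    with True show ?thesis
      by simp
  qed
  have "h (sum f A) = (\<Sum>x\<in>A. h (f x))" for f and A :: "int set"
    by (induction A rule: infinite_finite_induct) (simp_all add: add h0)
  then show ?thesis
    by (intro fls_eqI) (simp add: h0 fls_times_nth(2) sd mult)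
qed

section \<open>Laurent expansion of a rational function in one of its variables\<close>

definition ratfun_of_poly :: "((nat \<Rightarrow>\<^sub>0 nat) \<Rightarrow>\<^sub>0 'k::field) \<Rightarrow> 'k ratfun" where
  "ratfun_of_poly p = Fraction_Field.Fract p 1"

lemma ratfun_of_poly_zero [simp]: "ratfun_of_poly 0 = 0"
  by (simp add: ratfun_of_poly_def Zero_fract_def)

lemma ratfun_of_poly_eq_0_iff [simp]: "ratfun_of_poly p = 0 \<longleftrightarrow> p = 0"
  by (simp add: ratfun_of_poly_def Zero_fract_def eq_fract)

lemma ratfun_of_poly_add: "ratfun_of_poly (p + q) = ratfun_of_poly p + ratfun_of_poly q"
  by (simp add: ratfun_of_poly_def)

lemma ratfun_of_poly_mult: "ratfun_of_poly (p * q) = ratfun_of_poly p * ratfun_of_poly q"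
  by (simp add: ratfun_of_poly_def)

lemma ratfun_of_poly_sum: "ratfun_of_poly (sum f A) = (\<Sum>x\<in>A. ratfun_of_poly (f x))"
  by (induction A rule: infinite_finite_induct) (simp_all add: ratfun_of_poly_add)

lemma ratfun_act_of_poly: "bij \<sigma> \<Longrightarrow> ratfun_act \<sigma> (ratfun_of_poly p) = ratfun_of_poly (poly_act \<sigma> p)"
  by (simp add: ratfun_of_poly_def ratfun_act_Fract)

lemma Fract_conv_of_poly: "Fraction_Field.Fract a b = ratfun_of_poly a / ratfun_of_poly b"
  by (simp add: ratfun_of_poly_def)

text \<open>The variable \<open>\<xi>\<^sub>w\<close> becomes the series variable, so all coefficients are free of \<open>\<xi>\<^sub>w\<close>.\<close>

definition laurent_monom :: "nat \<Rightarrow> (nat \<Rightarrow>\<^sub>0 nat) \<Rightarrow> 'k::field \<Rightarrow> 'k ratfun fls" where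
  "laurent_monom w m c =
    fls_const (ratfun_of_poly (Poly_Mapping.single (Poly_Mapping.update w 0 m) c)) * fls_X ^ Poly_Mapping.lookup m w"

definition laurent_poly :: "nat \<Rightarrow> ((nat \<Rightarrow>\<^sub>0 nat) \<Rightarrow>\<^sub>0 'k::field) \<Rightarrow> 'k ratfun fls" where
  "laurent_poly w p = (\<Sum>m\<in>Poly_Mapping.keys p. laurent_monom w m (Poly_Mapping.lookup p m))"

lemma laurent_monom_0 [simp]: "laurent_monom w m 0 = 0"
  by (simp add: laurent_monom_def)

lemma laurent_monom_add: "laurent_monom w m (c + d) = laurent_monom w m c + laurent_monom w m d"
  by (simp add: laurent_monom_def single_add ratfun_of_poly_add distrib_right flip: fls_plus_const)

lemma update_add: "Poly_Mapping.update w 0 (m + m') = Poly_Mapping.update w 0 m + (Poly_Mapping.update w 0 m' :: 'a \<Rightarrow>\<^sub>0 nat)"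
  by (rule poly_mapping_eqI) (simp add: lookup_update lookup_add)

lemma laurent_monom_mult:
  "laurent_monom w (m + m') (c * d) = laurent_monom w m c * laurent_monom w m' d"
  by (simp add: laurent_monom_def lookup_add power_add update_add ratfun_of_poly_mult mult_ac
      flip: mult_single fls_const_mult_const)

lemma laurent_poly_superset:
  assumes "finite A" "Poly_Mapping.keys p \<subseteq> A"
  shows "laurent_poly w p = (\<Sum>m\<in>A. laurent_monom w m (Poly_Mapping.lookup p m))"
  unfolding laurent_poly_def
  by (rule sum.mono_neutral_left) (use assms in \<open>auto simp: in_keys_iff\<close>)

lemma laurent_poly_zero [simp]: "laurent_poly w 0 = 0"
  by (simp add: laurent_poly_def)

lemma laurent_poly_add: "laurent_poly w (p + q) = laurent_poly w p + laurent_poly w q"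
  using Poly_Mapping.keys_add[of p q]
  by (simp add: laurent_poly_superset[of "Poly_Mapping.keys p \<union> Poly_Mapping.keys q"] lookup_add
      laurent_monom_add sum.distrib)

lemma laurent_poly_single [simp]: "laurent_poly w (Poly_Mapping.single m c) = laurent_monom w m c"
  by (cases "c = 0") (simp_all add: laurent_poly_def)

lemma laurent_poly_mult: "laurent_poly w (p * q) = laurent_poly w p * laurent_poly w q"
proof (induction p rule: poly_mapping_additive_induct)
  case (single m c)
  show ?case
    by (induction q rule: poly_mapping_additive_induct)
       (simp_all add: mult_single laurent_monom_mult distrib_left laurent_poly_add)
qed (simp_all add: distrib_right laurent_poly_add)

text \<open>This makes the quotient defining \<open>laurent\<close> legitimate. If \<open>m0\<close>
  occurs in \<open>p\<close> with exponent n at \<open>w\<close>, look at the coefficient of degree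
  n: a monomial is recovered from its exponent at \<open>w\<close> and the remaining exponents, so
  the monomials contributing to this coefficient stay distinct and cannot cancel.\<close>

lemma laurent_poly_eq_0_iff [simp]: "laurent_poly w p = 0 \<longleftrightarrow> p = 0"
proof
  assume p0: "laurent_poly w p = 0"
  show "p = 0"
  proof (rule ccontr)
    assume "p \<noteq> 0"
    then obtain m0 where m0: "m0 \<in> Poly_Mapping.keys p"
      by (metis all_not_in_conv keys_eq_empty)
    define n where "n = Poly_Mapping.lookup m0 w"
    let ?t = "\<lambda>m. Poly_Mapping.single (Poly_Mapping.update w 0 m) (Poly_Mapping.lookup p m)"
    let ?q = "\<Sum>m\<in>Poly_Mapping.keys p. if Poly_Mapping.lookup m w = n then ?t m else 0"
    have nth: "fls_nth (laurent_monom w m c) (int n) =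
        ratfun_of_poly (if Poly_Mapping.lookup m w = n then Poly_Mapping.single (Poly_Mapping.update w 0 m) c else 0)"
      for m and c :: 'a
      by (auto simp: laurent_monom_def fls_X_power_times_conv_shift)
    have "fls_nth (\<Sum>m\<in>A. f m) k = (\<Sum>m\<in>A. fls_nth (f m) k)"
      for A k and f :: "(nat \<Rightarrow>\<^sub>0 nat) \<Rightarrow> 'a ratfun fls"
      by (induction A rule: infinite_finite_induct) simp_all
    then have "fls_nth (laurent_poly w p) (int n) = ratfun_of_poly ?q"
      by (simp add: laurent_poly_def nth ratfun_of_poly_sum)
    with p0 have "?q = 0"
      by simp
    moreover have "Poly_Mapping.lookup ?q (Poly_Mapping.update w 0 m0) =
        (\<Sum>m\<in>Poly_Mapping.keys p. if m = m0 then Poly_Mapping.lookup p m else 0)"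
      unfolding Poly_Mapping.lookup_sum
    proof (rule sum.cong)
      fix m
      have "m = m0" if "Poly_Mapping.lookup m w = n" "Poly_Mapping.update w 0 m = Poly_Mapping.update w 0 m0"
      proof (rule poly_mapping_eqI)
        fix i
        from arg_cong[OF that(2), of "\<lambda>x. Poly_Mapping.lookup x i"] that(1)
        show "Poly_Mapping.lookup m i = Poly_Mapping.lookup m0 i"
          by (auto simp: lookup_update n_def split: if_splits)
      qed
      then show "Poly_Mapping.lookup (if Poly_Mapping.lookup m w = n then ?t m else 0) (Poly_Mapping.update w 0 m0) =
          (if m = m0 then Poly_Mapping.lookup p m else 0)"
        by (auto simp: lookup_single when_def n_def)
    qed simp
    ultimately show False
      using m0 by (simp add: in_keys_iff)
  qed
qed simp

text \<open>Laurent rather than power series, because a denominator may be divisible by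
  \<open>\<xi>\<^sub>w\<close>; the target is a field, so every nonzero denominator becomes
  invertible there.\<close>

lift_definition laurent :: "nat \<Rightarrow> 'k::field ratfun \<Rightarrow> 'k ratfun fls"
  is "\<lambda>w (a, b). laurent_poly w a / laurent_poly w b"
  by (auto simp: frac_eq_eq simp flip: laurent_poly_mult)

lemma laurent_Fract: "b \<noteq> 0 \<Longrightarrow> laurent w (Fraction_Field.Fract a b) = laurent_poly w a / laurent_poly w b"
  by transfer auto

lemma laurent_add: "laurent w (x + y) = laurent w x + laurent w y"
  by (cases x; cases y) (simp add: laurent_Fract laurent_poly_add laurent_poly_mult add_frac_eq)

definition poly_free :: "nat \<Rightarrow> ((nat \<Rightarrow>\<^sub>0 nat) \<Rightarrow>\<^sub>0 'k::zero) \<Rightarrow> bool" where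
  "poly_free w p \<longleftrightarrow> (\<forall>m\<in>Poly_Mapping.keys p. w \<notin> Poly_Mapping.keys m)"

lemma poly_free_eventually: "\<exists>k. \<forall>u>k. poly_free u p"
proof -
  have "finite (\<Union>m\<in>Poly_Mapping.keys p. Poly_Mapping.keys m)"
    by simp
  then obtain k where "\<forall>u\<in>(\<Union>m\<in>Poly_Mapping.keys p. Poly_Mapping.keys m). u \<le> k"
    using finite_nat_set_iff_bounded_le by blast
  then show ?thesis
    unfolding poly_free_def by (metis UN_I leD)
qed

lemma laurent_poly_free:
  assumes "poly_free w p"
  shows "laurent_poly w p = fls_const (ratfun_of_poly p)"
proof -
  have "laurent_monom w m (Poly_Mapping.lookup p m) =
      fls_const (ratfun_of_poly (Poly_Mapping.single m (Poly_Mapping.lookup p m)))"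
    if "m \<in> Poly_Mapping.keys p" for m
  proof -
    have "Poly_Mapping.lookup m w = 0"
      using assms that by (auto simp: poly_free_def in_keys_iff)
    moreover from this have "Poly_Mapping.update w 0 m = m"
      by (intro poly_mapping_eqI) (auto simp: lookup_update)
    ultimately show ?thesis
      by (simp add: laurent_monom_def)
  qed
  then have "laurent_poly w p =
      (\<Sum>m\<in>Poly_Mapping.keys p. fls_const (ratfun_of_poly (Poly_Mapping.single m (Poly_Mapping.lookup p m))))"
    by (simp add: laurent_poly_def)
  also have "\<dots> = fls_const (ratfun_of_poly (\<Sum>m\<in>Poly_Mapping.keys p. Poly_Mapping.single m (Poly_Mapping.lookup p m)))"
  proof -
    have "(\<Sum>m\<in>A. fls_const (f m)) = fls_const (sum f A)" for A and f :: "_ \<Rightarrow> 'a ratfun"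
      by (induction A rule: infinite_finite_induct) (simp_all add: fls_plus_const)
    then show ?thesis
      by (simp add: ratfun_of_poly_sum)
  qed
  finally show ?thesis
    by (simp add: poly_mapping_sum_monomials)
qed

section \<open>Behaviour of the expansion under permutations of the variables\<close>

lemma lookup_pushforward:
  assumes "bij \<sigma>"
  shows "Poly_Mapping.lookup (pushforward \<sigma> p) (\<sigma> x) = Poly_Mapping.lookup p x"
  by (induction p rule: poly_mapping_additive_induct)
     (use assms in \<open>auto simp: pushforward_add lookup_add lookup_single when_def bij_def inj_eq\<close>)

lemma poly_act_single [simp]:
  "poly_act \<sigma> (Poly_Mapping.single m c) = Poly_Mapping.single (pushforward \<sigma> m) c"
  by (simp add: poly_act_def)

lemma keys_poly_act: "Poly_Mapping.keys (poly_act \<sigma> p) \<subseteq> pushforward \<sigma> ` Poly_Mapping.keys p"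
  unfolding poly_act_def by (rule keys_pushforward)

lemma poly_free_act:
  assumes "bij \<sigma>" "poly_free w p"
  shows "poly_free (\<sigma> w) (poly_act \<sigma> p)"
proof -
  have "\<sigma> w \<notin> Poly_Mapping.keys (pushforward \<sigma> m)" if "w \<notin> Poly_Mapping.keys m" for m :: "nat \<Rightarrow>\<^sub>0 nat"
    using that assms(1) by (simp add: in_keys_iff lookup_pushforward)
  then show ?thesis
    using assms(2) keys_poly_act[of \<sigma> p] by (fastforce simp: poly_free_def)
qed

lemma ratfun_act_eq_0_iff:
  assumes "bij \<sigma>"
  shows "ratfun_act \<sigma> x = 0 \<longleftrightarrow> x = 0"
proof
  assume "ratfun_act \<sigma> x = 0"
  then have "ratfun_act (inv_into UNIV \<sigma>) (ratfun_act \<sigma> x) = 0"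
    using assms by (simp add: bij_imp_bij_inv)
  then show "x = 0"
    using assms by (simp add: bij_imp_bij_inv bij_is_inj flip: ratfun_act_comp)
qed (use assms in simp)

abbreviation ratfun_fls_act :: "(nat \<Rightarrow> nat) \<Rightarrow> 'k::field ratfun fls \<Rightarrow> 'k ratfun fls" where
  "ratfun_fls_act \<sigma> \<equiv> fls_map (ratfun_act \<sigma>)"

lemma ratfun_fls_act_laurent_monom:
  fixes c :: "'k::field"
  assumes "bij \<sigma>"
  shows "ratfun_fls_act \<sigma> (laurent_monom w m c) =
    fls_const (ratfun_of_poly (Poly_Mapping.single (pushforward \<sigma> (Poly_Mapping.update w 0 m)) c)) *
    fls_X ^ Poly_Mapping.lookup m w"
proof -
  have "ratfun_fls_act \<sigma> (fls_const a * fls_X ^ n) = fls_const (ratfun_act \<sigma> a) * fls_X ^ n"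
    for a :: "'k ratfun" and n
    by (rule fls_eqI) (simp add: assms fls_X_power_times_conv_shift)
  then show ?thesis
    by (simp add: laurent_monom_def ratfun_act_of_poly assms)
qed

lemma ratfun_fls_act_add:
  "bij \<sigma> \<Longrightarrow> ratfun_fls_act \<sigma> (F + G) = ratfun_fls_act \<sigma> F + ratfun_fls_act \<sigma> G"
  by (simp add: fls_map_add ratfun_act_add)

lemma ratfun_fls_act_zero: "bij \<sigma> \<Longrightarrow> ratfun_fls_act \<sigma> 0 = 0"
  by (simp add: fls_map_eq_0_iff ratfun_act_eq_0_iff)

lemma ratfun_fls_act_divide:
  assumes "bij \<sigma>" "G \<noteq> 0"
  shows "ratfun_fls_act \<sigma> (F / G) = ratfun_fls_act \<sigma> F / ratfun_fls_act \<sigma> G"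
proof -
  have "ratfun_fls_act \<sigma> (F / G) * ratfun_fls_act \<sigma> G = ratfun_fls_act \<sigma> (F / G * G)"
    by (rule fls_map_mult[symmetric])
       (use assms in \<open>simp_all add: ratfun_act_eq_0_iff ratfun_act_add ratfun_act_mult\<close>)
  moreover have "ratfun_fls_act \<sigma> G \<noteq> 0"
    using assms by (simp add: fls_map_eq_0_iff ratfun_act_eq_0_iff)
  ultimately show ?thesis
    using assms by (simp add: field_simps)
qed

text \<open>Because \<sigma> fixes \<open>w\<close>, it leaves the series variable alone and only
  renames variables inside the coefficients.\<close>

lemma laurent_act:
  assumes "bij \<sigma>" "\<sigma> w = w"
  shows "laurent w (ratfun_act \<sigma> x) = ratfun_fls_act \<sigma> (laurent w x)"
proof -
  have "laurent_monom w (pushforward \<sigma> m) c = ratfun_fls_act \<sigma> (laurent_monom w m c)" for m and c :: 'a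
  proof -
    have 1: "Poly_Mapping.lookup (pushforward \<sigma> m) w = Poly_Mapping.lookup m w"
      using lookup_pushforward[OF assms(1), of m w] assms(2) by simp
    have 2: "Poly_Mapping.update w 0 (pushforward \<sigma> m) = pushforward \<sigma> (Poly_Mapping.update w 0 m)"
    proof (rule poly_mapping_eqI)
      fix i
      obtain j where "i = \<sigma> j"
        using assms(1) by (metis bij_pointE)
      then show "Poly_Mapping.lookup (Poly_Mapping.update w 0 (pushforward \<sigma> m)) i =
          Poly_Mapping.lookup (pushforward \<sigma> (Poly_Mapping.update w 0 m)) i"
        using assms by (simp add: lookup_update lookup_pushforward) (metis bij_def inj_eq)
    qed
    show ?thesis
      using 1 2 by (simp add: ratfun_fls_act_laurent_monom assms(1)) (simp add: laurent_monom_def)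
  qed
  then have poly: "laurent_poly w (poly_act \<sigma> p) = ratfun_fls_act \<sigma> (laurent_poly w p)" for p :: "_ \<Rightarrow>\<^sub>0 'a"
    by (induction p rule: poly_mapping_additive_induct)
       (simp_all add: assms(1) poly_act_add laurent_poly_add ratfun_fls_act_add ratfun_fls_act_zero)
  then show ?thesis
    using assms(1) by (cases x) (simp add: ratfun_act_Fract laurent_Fract poly_act_eq_0_iff ratfun_fls_act_divide)
qed

text \<open>The expansions of numerator and denominator involve finitely many variables, none of
  them \<open>\<xi>\<^sub>w\<close>. Beyond these, \<open>u\<close> and \<open>w\<close> are both
  absent, so the transposition fixes both series and hence their quotient. The bound k is thus
  uniform over the infinitely many coefficients.\<close>

lemma ratfun_fls_act_laurent:
  "\<exists>k. \<forall>u>k. ratfun_fls_act (Transposition.transpose w u) (laurent w x) = laurent w x"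
proof -
  let ?t = "Transposition.transpose w"
  have poly: "\<exists>k. \<forall>u>k. ratfun_fls_act (?t u) (laurent_poly w p) = laurent_poly w p"
    for p :: "_ \<Rightarrow>\<^sub>0 'a"
  proof (induction p rule: poly_mapping_additive_induct)
    case (single m c)
    obtain k where k: "\<forall>i\<in>Poly_Mapping.keys m. i \<le> k"
      using finite_nat_set_iff_bounded_le[of "Poly_Mapping.keys m"] by auto
    have "pushforward (?t u) (Poly_Mapping.update w 0 m) = Poly_Mapping.update w 0 m" if "u > k" for u
    proof -
      have "pushforward (?t u) (Poly_Mapping.update w 0 m) = pushforward id (Poly_Mapping.update w 0 m)"
      proof (rule pushforward_cong)
        fix i assume "i \<in> Poly_Mapping.keys (Poly_Mapping.update w 0 m)"
        then have "i \<noteq> w" "i \<in> Poly_Mapping.keys m"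
          by (auto simp: in_keys_iff lookup_update split: if_splits)
        with k that show "?t u i = id i"
          by force
      qed
      then show ?thesis
        by simp
    qed
    then show ?case
      by (intro exI[of _ k]) (simp add: ratfun_fls_act_laurent_monom, simp add: laurent_monom_def)
  next
    case (add p q)
    then obtain k l where "\<forall>u>k. ratfun_fls_act (?t u) (laurent_poly w p) = laurent_poly w p"
      "\<forall>u>l. ratfun_fls_act (?t u) (laurent_poly w q) = laurent_poly w q"
      by blast
    then show ?case
      by (intro exI[of _ "max k l"]) (simp add: laurent_poly_add ratfun_fls_act_add)
  qed (simp add: ratfun_fls_act_zero)
  obtain a b where x: "x = Fraction_Field.Fract a b" "b \<noteq> 0"
    by (cases x)
  obtain k l where "\<forall>u>k. ratfun_fls_act (?t u) (laurent_poly w a) = laurent_poly w a"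
    "\<forall>u>l. ratfun_fls_act (?t u) (laurent_poly w b) = laurent_poly w b"
    using poly by blast
  with x show ?thesis
    by (intro exI[of _ "max k l"]) (simp add: laurent_Fract ratfun_fls_act_divide)
qed

section \<open>The projection onto rational functions free of one variable\<close>

definition ratfun_drop :: "nat \<Rightarrow> 'k::field ratfun \<Rightarrow> 'k ratfun" where
  "ratfun_drop w x = fls_nth (laurent w x) 0"

text \<open>The constant coefficient is additive but not multiplicative:
  \<open>\<xi>\<^sub>w\<close> and its inverse both go to 0, their product to 1.\<close>

lemma ratfun_drop_add: "ratfun_drop w (x + y) = ratfun_drop w x + ratfun_drop w y"
  by (simp add: ratfun_drop_def laurent_add)

lemma ratfun_drop_zero [simp]: "ratfun_drop w 0 = 0"
  using ratfun_drop_add[of w 0 0] by (metis add.right_neutral add_left_cancel)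

lemma ratfun_drop_act:
  "bij \<sigma> \<Longrightarrow> \<sigma> w = w \<Longrightarrow> ratfun_drop w (ratfun_act \<sigma> x) = ratfun_act \<sigma> (ratfun_drop w x)"
  by (simp add: ratfun_drop_def laurent_act)

lemma ratfun_act_drop:
  "\<exists>k. \<forall>u>k. ratfun_act (Transposition.transpose w u) (ratfun_drop w x) = ratfun_drop w x"
proof -
  obtain k where k: "\<And>u. u > k \<Longrightarrow> ratfun_fls_act (Transposition.transpose w u) (laurent w x) = laurent w x"
    using ratfun_fls_act_laurent[of w x] by blast
  show ?thesis
    using arg_cong[OF k, of _ "\<lambda>F. fls_nth F 0"]
    by (intro exI[of _ k]) (simp add: ratfun_drop_def)
qed

text \<open>Invariance under (w u) for a single \<open>u\<close> that occurs in neither numerator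
  nor denominator already suffices: applying the transposition to the fraction writes
  \<open>x\<close> as a fraction without \<open>\<xi>\<^sub>w\<close>, and such a fraction expands
  to a constant series.\<close>

lemma ratfun_drop_eq:
  assumes "\<forall>u>k. ratfun_act (Transposition.transpose w u) x = x"
  shows "ratfun_drop w x = x"
proof -
  obtain a b where x: "x = Fraction_Field.Fract a b" "b \<noteq> 0"
    by (cases x)
  obtain l l' where l: "\<forall>u>l. poly_free u a" "\<forall>u>l'. poly_free u b"
    using poly_free_eventually by blast
  define u where "u = Suc (max k (max l l'))"
  let ?t = "Transposition.transpose w u"
  have "poly_free u a" "poly_free u b"
    using l by (simp_all add: u_def)
  then have free: "poly_free w (poly_act ?t a)" "poly_free w (poly_act ?t b)"
    using poly_free_act[of ?t u] by simp_all
  have nz: "poly_act ?t b \<noteq> 0"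
    using x by (simp add: poly_act_eq_0_iff)
  have "x = ratfun_act ?t x"
    using assms by (simp add: u_def)
  also have "\<dots> = Fraction_Field.Fract (poly_act ?t a) (poly_act ?t b)"
    by (simp add: x ratfun_act_Fract)
  finally have x': "x = Fraction_Field.Fract (poly_act ?t a) (poly_act ?t b)" .
  then have "laurent w x = fls_const (ratfun_of_poly (poly_act ?t a)) / fls_const (ratfun_of_poly (poly_act ?t b))"
    using nz by (simp add: laurent_Fract laurent_poly_free free)
  also have "\<dots> = fls_const (ratfun_of_poly (poly_act ?t a) / ratfun_of_poly (poly_act ?t b))"
    using nz by (simp add: divide_eq_eq)
  also have "\<dots> = fls_const x"
    using x' by (simp add: Fract_conv_of_poly)
  finally show ?thesis
    by (simp add: ratfun_drop_def)
qed

section \<open>The infinite symmetric group\<close>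

lemma transpose_inf_sym [simp]: "Transposition.transpose a b \<in> inf_sym"
proof -
  have "Transposition.transpose a b permutes {..<Suc (max a b)}"
    by (rule permutes_swap_id) simp_all
  then show ?thesis
    unfolding inf_sym_def by (intro UN_I[of "Suc (max a b)"]) simp_all
qed

lemma inf_sym_inv: "\<sigma> \<in> inf_sym \<Longrightarrow> inv_into UNIV \<sigma> \<in> inf_sym"
  by (auto simp: inf_sym_def intro: permutes_inv)

lemma inf_sym_inj: "\<sigma> \<in> inf_sym \<Longrightarrow> inj \<sigma>"
  by (simp add: bij_is_inj inf_sym_bij)

lemma inf_sym_comp_inv:
  assumes "\<sigma> \<in> inf_sym"
  shows "\<sigma> \<circ> inv_into UNIV \<sigma> = id" "inv_into UNIV \<sigma> \<circ> \<sigma> = id"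
  using inf_sym_bij[OF assms] by (simp_all add: bij_is_inj bij_is_surj flip: surj_iff)

lemma inf_sym_eventually_fix:
  assumes "\<sigma> \<in> inf_sym"
  shows "\<exists>k. \<forall>u>k. \<sigma> u = u"
proof -
  obtain n where "\<sigma> permutes {..<n}"
    using assms by (auto simp: inf_sym_def)
  then show ?thesis
    by (intro exI[of _ n]) (simp add: permutes_def)
qed

lemma inf_sym_permutes: "\<pi> permutes {..<n} \<Longrightarrow> \<pi> \<in> inf_sym"
  unfolding inf_sym_def
  by (rule UN_I[of "Suc n"]) (auto intro: permutes_subset)

lemma bij_image_set: "bij \<sigma> \<Longrightarrow> bij ((`) \<sigma>)"
  by (metis bij_betw_Pow Pow_UNIV)


section \<open>Removing a point from a representation\<close>

text \<open>A vector fixed by \<open>(w u)\<close> for all large \<open>u\<close> is one that does not involve the point \<open>w\<close>.\<close>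

definition point_retraction :: "('k::field ratfun, 'b) semirep \<Rightarrow> nat \<Rightarrow> ('b \<Rightarrow> 'b) \<Rightarrow> bool" where
  "point_retraction M w L \<longleftrightarrow> L \<in> carrier M \<rightarrow> carrier M \<and>
     (\<forall>x\<in>carrier M. \<forall>y\<in>carrier M. L (x \<oplus>\<^bsub>M\<^esub> y) = L x \<oplus>\<^bsub>M\<^esub> L y) \<and>
     (\<forall>\<sigma>\<in>inf_sym. \<sigma> w = w \<longrightarrow> (\<forall>x\<in>carrier M. L (act M \<sigma> x) = act M \<sigma> (L x))) \<and>
     (\<forall>x\<in>carrier M. \<exists>k. \<forall>u>k. act M (Transposition.transpose w u) (L x) = L x) \<and>
     (\<forall>x\<in>carrier M. \<forall>k. (\<forall>u>k. act M (Transposition.transpose w u) x = x) \<longrightarrow> L x = x)"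

text \<open>A standard subobject is only known up to isomorphism, so the projection built on the
  model \<open>N\<close> is conjugated by \<open>f\<close>.\<close>

lemma point_retraction_iso:
  assumes M: "smooth_semirep M" and f: "f \<in> semirep_hom M N" "bij_betw f (carrier M) (carrier N)"
    and L: "point_retraction N w L"
  shows "\<exists>L. point_retraction M w L"
proof -
  interpret smooth_semirep M by (rule M)
  define L' where "L' x = inv_into (carrier M) f (L (f x))" for x
  have fN: "f x \<in> carrier N" if "x \<in> carrier M" for x
    using f(2) that by (auto simp: bij_betw_def)
  have LN: "L y \<in> carrier N" if "y \<in> carrier N" for y
    using L that by (auto simp: point_retraction_def)
  have L'M: "L' x \<in> carrier M" and fL': "f (L' x) = L (f x)" if "x \<in> carrier M" for x
    using LN[OF fN[OF that]] f(2) unfolding L'_def bij_betw_def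
    by (auto simp: f_inv_into_f intro: inv_into_into)
  have inj: "x = y" if "f x = f y" "x \<in> carrier M" "y \<in> carrier M" for x y
    using f(2) that by (auto simp: bij_betw_def dest: inj_onD)
  have hom: "f (x \<oplus>\<^bsub>M\<^esub> y) = f x \<oplus>\<^bsub>N\<^esub> f y" "\<sigma> \<in> inf_sym \<Longrightarrow> f (act M \<sigma> x) = act N \<sigma> (f x)"
    if "x \<in> carrier M" "y \<in> carrier M" for x y \<sigma>
    using f(1) that by (auto simp: semirep_hom_def)
  have "point_retraction M w L'"
    unfolding point_retraction_def
  proof (intro conjI ballI allI impI)
    show "L' \<in> carrier M \<rightarrow> carrier M"
      using L'M by auto
    fix x assume x: "x \<in> carrier M"
    show "L' (x \<oplus>\<^bsub>M\<^esub> y) = L' x \<oplus>\<^bsub>M\<^esub> L' y" if y: "y \<in> carrier M" for y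
      by (rule inj) (use x y L fN in \<open>auto simp: hom L'M fL' point_retraction_def\<close>)
    show "L' (act M \<sigma> x) = act M \<sigma> (L' x)" if "\<sigma> \<in> inf_sym" "\<sigma> w = w" for \<sigma>
      by (rule inj) (use x that L fN in \<open>auto simp: hom(2)[where y = x] hom(2)[where y = "L' x"] L'M fL' act_closed point_retraction_def\<close>)
    obtain k where "\<forall>u>k. act N (Transposition.transpose w u) (L (f x)) = L (f x)"
      using L fN[OF x] by (auto simp: point_retraction_def)
    then show "\<exists>k. \<forall>u>k. act M (Transposition.transpose w u) (L' x) = L' x"
      by (intro exI[of _ k] allI impI inj) (use x in \<open>auto simp: hom(2)[where y = "L' x"] L'M fL' act_closed\<close>)
    show "L' x = x" if "\<forall>u>k. act M (Transposition.transpose w u) x = x" for k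
    proof (rule inj)
      have "\<forall>u>k. act N (Transposition.transpose w u) (f x) = f x"
        using that x hom(2)[OF x x transpose_inf_sym] by metis
      then have "L (f x) = f x"
        using L fN[OF x] unfolding point_retraction_def by blast
      then show "f (L' x) = f x"
        using x by (simp add: fL')
    qed (use x L'M in auto)
  qed
  then show ?thesis
    by blast
qed

section \<open>Direct sums of the \<open>I_rep r\<close> in coordinates, and their
  projections\<close>

lemma lookup_I_act:
  assumes "\<sigma> \<in> inf_sym"
  shows "Poly_Mapping.lookup (act (I_rep r) \<sigma> x) (\<sigma> ` S) = ratfun_act \<sigma> (Poly_Mapping.lookup x S)"
  using lookup_pushforward[OF bij_image_set[OF inf_sym_bij[OF assms]],
      of "Poly_Mapping.map (ratfun_act \<sigma>) x" S] inf_sym_bij[OF assms]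
  by (simp add: I_rep_def Poly_Mapping.map.rep_eq when_def)

abbreviation I_sum :: "'j set \<Rightarrow> ('j \<Rightarrow> nat) \<Rightarrow> ('k::field ratfun, 'j \<Rightarrow> nat set \<Rightarrow>\<^sub>0 'k ratfun) semirep" where
  "I_sum J d \<equiv> direct_sum_semirep J (\<lambda>j. I_rep (d j))"

lemma I_sum_carrier: "x \<in> carrier (I_sum J d) \<longleftrightarrow> x \<in> extensional J \<and>
    (\<forall>j\<in>J. Poly_Mapping.keys (x j) \<subseteq> r_subsets (d j)) \<and> finite {j \<in> J. x j \<noteq> 0}"
  by (auto simp: direct_sum_semirep_def I_rep_def PiE_iff)

lemma I_sum_eqI:
  assumes "x \<in> extensional J" "y \<in> extensional J"
    and "\<And>j S. j \<in> J \<Longrightarrow> Poly_Mapping.lookup (x j) S = Poly_Mapping.lookup (y j) S"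
  shows "x = y"
  by (rule extensionalityI[OF assms(1,2)]) (auto intro: poly_mapping_eqI assms(3))

lemma I_sum_ops:
  "\<zero>\<^bsub>I_sum J d\<^esub> = (\<lambda>j\<in>J. 0)"
  "x \<oplus>\<^bsub>I_sum J d\<^esub> y = (\<lambda>j\<in>J. x j + y j)"
  "a \<odot>\<^bsub>I_sum J d\<^esub> x = (\<lambda>j\<in>J. Poly_Mapping.map ((*) a) (x j))"
  "act (I_sum J d) \<sigma> x = (\<lambda>j\<in>J. act (I_rep (d j)) \<sigma> (x j))"
  by (simp_all add: direct_sum_semirep_def I_rep_def)

lemma lookup_I_sum_act:
  "\<sigma> \<in> inf_sym \<Longrightarrow> j \<in> J \<Longrightarrow>
    Poly_Mapping.lookup (act (I_sum J d) \<sigma> x j) (\<sigma> ` S) = ratfun_act \<sigma> (Poly_Mapping.lookup (x j) S)"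
  by (simp add: I_sum_ops lookup_I_act)

definition I_support :: "'j set \<Rightarrow> ('j \<Rightarrow> nat set \<Rightarrow>\<^sub>0 'a::zero) \<Rightarrow> ('j \<times> nat set) set" where
  "I_support J x = (SIGMA j:J. Poly_Mapping.keys (x j))"

lemma finite_I_support:
  assumes "x \<in> carrier (I_sum J d)"
  shows "finite (I_support J x)"
proof -
  have "I_support J x = (SIGMA j:{j \<in> J. x j \<noteq> 0}. Poly_Mapping.keys (x j))"
    by (auto simp: I_support_def)
  then show ?thesis
    using assms by (simp add: I_sum_carrier)
qed

text \<open>Both conditions about large \<open>u\<close> rest on finite support, even when
  \<open>J\<close> is infinite. For \<open>u\<close> beyond all points that occur, (w u) fixes each
  set of the support that avoids \<open>w\<close>, while a set containing \<open>w\<close> is sent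
  to one containing \<open>u\<close>, which lies outside the support.\<close>

lemma I_sum_point_retraction:
  "\<exists>L. point_retraction (I_sum J d :: ('k::field ratfun, 'j \<Rightarrow> _) semirep) w L"
proof -
  let ?D = "I_sum J d :: ('k ratfun, 'j \<Rightarrow> _) semirep"
  let ?t = "Transposition.transpose w"
  define L :: "('j \<Rightarrow> nat set \<Rightarrow>\<^sub>0 'k ratfun) \<Rightarrow> _" where
    "L x = (\<lambda>j\<in>J. Poly_Mapping.mapp (\<lambda>S c. if w \<in> S then 0 else ratfun_drop w c) (x j))" for x
  have lookup_L: "Poly_Mapping.lookup (L x j) S =
      (if w \<in> S then 0 else ratfun_drop w (Poly_Mapping.lookup (x j) S))" if "j \<in> J" for x j S
    using that by (simp add: L_def lookup_mapp when_def in_keys_iff)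
  have L_ext: "L x \<in> extensional J" for x
    by (simp add: L_def)
  have keys_L: "Poly_Mapping.keys (L x j) \<subseteq> Poly_Mapping.keys (x j)" if "j \<in> J" for x j
    using lookup_L[OF that] by (auto simp: in_keys_iff split: if_splits)
  have L_closed: "L x \<in> carrier ?D" if "x \<in> carrier ?D" for x
  proof -
    have "{j \<in> J. L x j \<noteq> 0} \<subseteq> {j \<in> J. x j \<noteq> 0}"
      using keys_L[of _ x] by (auto simp flip: keys_eq_empty)
    then show ?thesis
      using that keys_L by (auto simp: I_sum_carrier L_ext dest: finite_subset) blast
  qed
  have act_image: "\<exists>T. S = \<sigma> ` T" if "\<sigma> \<in> inf_sym" for \<sigma> S
    using bij_image_set[OF inf_sym_bij[OF that]] by (metis bij_pointE)
  have bound: "\<exists>k. \<forall>j\<in>J. \<forall>S\<in>Poly_Mapping.keys (x j). \<forall>i\<in>S. i \<le> k" if "x \<in> carrier ?D" for x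
  proof -
    have "finite (\<Union>p\<in>I_support J x. snd p)"
      using that finite_I_support[OF that] by (auto simp: I_support_def I_sum_carrier r_subsets_def)
    then obtain k where "\<forall>i\<in>(\<Union>p\<in>I_support J x. snd p). i \<le> k"
      using finite_nat_set_iff_bounded_le by blast
    then show ?thesis
      by (intro exI[of _ k]) (force simp: I_support_def)
  qed
  have t_image: "?t u ` S = S" if "w \<notin> S" "u \<notin> S" for u S
    using that by simp
  have "point_retraction ?D w L"
    unfolding point_retraction_def
  proof (intro conjI ballI allI impI)
    show "L \<in> carrier ?D \<rightarrow> carrier ?D"
      using L_closed by auto
    fix x assume x: "x \<in> carrier ?D"
    show "L (x \<oplus>\<^bsub>?D\<^esub> y) = L x \<oplus>\<^bsub>?D\<^esub> L y" for y
      by (rule I_sum_eqI[OF L_ext])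
         (simp_all add: lookup_L I_sum_ops lookup_add ratfun_drop_add)
    show "L (act ?D \<sigma> x) = act ?D \<sigma> (L x)" if \<sigma>: "\<sigma> \<in> inf_sym" "\<sigma> w = w" for \<sigma>
    proof (rule I_sum_eqI[OF L_ext])
      fix j S assume j: "j \<in> J"
      obtain T where "S = \<sigma> ` T"
        using act_image[OF \<sigma>(1)] by blast
      moreover have "w \<in> \<sigma> ` T \<longleftrightarrow> w \<in> T"
        using \<sigma> inf_sym_inj[OF \<sigma>(1)] by (metis inj_image_mem_iff)
      ultimately show "Poly_Mapping.lookup (L (act ?D \<sigma> x) j) S = Poly_Mapping.lookup (act ?D \<sigma> (L x) j) S"
        using \<sigma> j by (simp add: lookup_L lookup_I_sum_act ratfun_drop_act inf_sym_bij)
    qed (simp add: I_sum_ops)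
    obtain k where k: "\<And>j S i. j \<in> J \<Longrightarrow> S \<in> Poly_Mapping.keys (x j) \<Longrightarrow> i \<in> S \<Longrightarrow> i \<le> k"
      using bound[OF x] by blast
    show "\<exists>k. \<forall>u>k. act ?D (?t u) (L x) = L x"
    proof -
      have "\<forall>p. \<exists>l. \<forall>u>l. ratfun_act (?t u) (ratfun_drop w (Poly_Mapping.lookup (x (fst p)) (snd p))) =
          ratfun_drop w (Poly_Mapping.lookup (x (fst p)) (snd p))"
        using ratfun_act_drop by blast
      then obtain l where l: "\<And>p u. u > l p \<Longrightarrow>
          ratfun_act (?t u) (ratfun_drop w (Poly_Mapping.lookup (x (fst p)) (snd p))) =
          ratfun_drop w (Poly_Mapping.lookup (x (fst p)) (snd p))"
        by metis
      \<comment> \<open>The bounds \<open>l p\<close> depend on the coefficient; finiteness of the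
        support turns them into one.\<close>
      obtain l' where l': "\<And>p. p \<in> I_support J x \<Longrightarrow> l p \<le> l'"
        using finite_nat_set_iff_bounded_le[of "l ` I_support J x"] finite_I_support[OF x] by auto
      have "act ?D (?t u) (L x) = L x" if u: "u > max k l'" for u
      proof (rule I_sum_eqI[OF _ L_ext])
        fix j S assume j: "j \<in> J"
        obtain T where T: "S = ?t u ` T"
          using act_image[OF transpose_inf_sym] by blast
        have supp: "?t u ` U = U \<and> (j, U) \<in> I_support J x" if "Poly_Mapping.lookup (L x j) U \<noteq> 0" for U
        proof -
          have U: "w \<notin> U" "U \<in> Poly_Mapping.keys (x j)"
            using that j by (auto simp: lookup_L in_keys_iff split: if_splits)
          moreover from k[OF j U(2)] u have "u \<notin> U"
            by force
          ultimately show ?thesis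
            using j t_image by (simp add: I_support_def)
        qed
        have "ratfun_act (?t u) (Poly_Mapping.lookup (L x j) T) = Poly_Mapping.lookup (L x j) (?t u ` T)"
        proof (cases "Poly_Mapping.lookup (L x j) T = 0")
          case True
          \<comment> \<open>If the coefficient at the image of \<open>T\<close> were nonzero, that
            image would be a set fixed by the transposition. Being an involution, the transposition
            would then also fix \<open>T\<close>, so the coefficient at \<open>T\<close> would be
            nonzero.\<close>
          have "Poly_Mapping.lookup (L x j) (?t u ` T) = 0"
          proof (rule ccontr)
            assume *: "Poly_Mapping.lookup (L x j) (?t u ` T) \<noteq> 0"
            have "T = ?t u ` (?t u ` T)"
              by (simp add: image_image)
            also have "\<dots> = ?t u ` T"
              using supp[OF *] by simp
            finally show False
              using * True by simp
          qed
          with True show ?thesis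
            by simp
        next
          case False
          with supp[OF False] l[of "(j, T)" u] l'[of "(j, T)"] u j show ?thesis
            by (auto simp: lookup_L)
        qed
        then show "Poly_Mapping.lookup (act ?D (?t u) (L x) j) S = Poly_Mapping.lookup (L x j) S"
          using j by (simp add: T lookup_I_sum_act)
      qed (simp add: I_sum_ops)
      then show ?thesis
        by blast
    qed
    show "L x = x" if l: "\<forall>u>l. act ?D (?t u) x = x" for l
    proof (rule I_sum_eqI[OF L_ext])
      show "x \<in> extensional J"
        using x by (simp add: I_sum_carrier)
      fix j S assume j: "j \<in> J"
      have xt: "Poly_Mapping.lookup (x j) (?t u ` S) = ratfun_act (?t u) (Poly_Mapping.lookup (x j) S)"
        if "u > l" for u
        using lookup_I_sum_act[of "?t u" j J d x S] l that j by simp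
      show "Poly_Mapping.lookup (L x j) S = Poly_Mapping.lookup (x j) S"
      proof (cases "S \<in> Poly_Mapping.keys (x j)")
        case True
        \<comment> \<open>Otherwise invariance of \<open>x\<close> would put a set containing
          \<open>u\<close> into the support, although \<open>u\<close> was chosen beyond all its
          points.\<close>
        have "w \<notin> S"
        proof
          assume "w \<in> S"
          define u where "u = Suc (max k l)"
          have "u \<in> ?t u ` S"
            using \<open>w \<in> S\<close> by (metis imageI transpose_apply_first)
          moreover have "?t u ` S \<in> Poly_Mapping.keys (x j)"
            using True xt[of u] by (simp add: u_def in_keys_iff ratfun_act_eq_0_iff)
          ultimately have "u \<le> k"
            using k[OF j] by blast
          then show False
            by (simp add: u_def)
        qed
        have "ratfun_act (?t u) (Poly_Mapping.lookup (x j) S) = Poly_Mapping.lookup (x j) S"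
          if "u > max k l" for u
        proof -
          have "u \<notin> S"
            using k[OF j True, of u] that by auto
          then have "?t u ` S = S"
            using \<open>w \<notin> S\<close> t_image by blast
          then show ?thesis
            using xt[of u] that by simp
        qed
        then have "ratfun_drop w (Poly_Mapping.lookup (x j) S) = Poly_Mapping.lookup (x j) S"
          by (intro ratfun_drop_eq[of "max k l"]) blast
        with \<open>w \<notin> S\<close> j show ?thesis
          by (simp add: lookup_L)
      qed (use j in \<open>simp add: lookup_L in_keys_iff\<close>)
    qed
  qed
  then show ?thesis
    by blast
qed

section \<open>Lifting invariants\<close>

context smooth_semirep
begin

lemma smult_closed' [simp, intro]: "v \<in> carrier M \<Longrightarrow> a \<odot>\<^bsub>M\<^esub> v \<in> carrier M"
  using smult_closed[of a v] by (simp add: ratfun_ring_def)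

lemma smult_add_l: "v \<in> carrier M \<Longrightarrow> (a + b) \<odot>\<^bsub>M\<^esub> v = a \<odot>\<^bsub>M\<^esub> v \<oplus>\<^bsub>M\<^esub> b \<odot>\<^bsub>M\<^esub> v"
  using smult_l_distr[of a b v] by (simp add: ratfun_ring_def)

lemma smult_add_r:
  "v \<in> carrier M \<Longrightarrow> w \<in> carrier M \<Longrightarrow> a \<odot>\<^bsub>M\<^esub> (v \<oplus>\<^bsub>M\<^esub> w) = a \<odot>\<^bsub>M\<^esub> v \<oplus>\<^bsub>M\<^esub> a \<odot>\<^bsub>M\<^esub> w"
  using smult_r_distr[of a v w] by (simp add: ratfun_ring_def)

lemma smult_mult: "v \<in> carrier M \<Longrightarrow> (a * b) \<odot>\<^bsub>M\<^esub> v = a \<odot>\<^bsub>M\<^esub> (b \<odot>\<^bsub>M\<^esub> v)"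
  using smult_assoc1[of a b v] by (simp add: ratfun_ring_def)

lemma smult_1: "v \<in> carrier M \<Longrightarrow> 1 \<odot>\<^bsub>M\<^esub> v = v"
  using smult_one[of v] by (simp add: ratfun_ring_def)

lemma smult_0: "v \<in> carrier M \<Longrightarrow> 0 \<odot>\<^bsub>M\<^esub> v = \<zero>\<^bsub>M\<^esub>"
  using smult_l_null[of v] by (simp add: ratfun_ring_def)

lemma act_zero: "\<sigma> \<in> inf_sym \<Longrightarrow> act M \<sigma> \<zero>\<^bsub>M\<^esub> = \<zero>\<^bsub>M\<^esub>"
  using act_add[of \<sigma> "\<zero>\<^bsub>M\<^esub>" "\<zero>\<^bsub>M\<^esub>"] act_closed[of \<sigma> "\<zero>\<^bsub>M\<^esub>"] by simp

lemma subrepD: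
  assumes "subrep N M"
  shows "N \<subseteq> carrier M" "\<zero>\<^bsub>M\<^esub> \<in> N"
    "\<And>x y. x \<in> N \<Longrightarrow> y \<in> N \<Longrightarrow> x \<oplus>\<^bsub>M\<^esub> y \<in> N"
    "\<And>x. x \<in> N \<Longrightarrow> \<ominus>\<^bsub>M\<^esub> x \<in> N"
    "\<And>a x. x \<in> N \<Longrightarrow> a \<odot>\<^bsub>M\<^esub> x \<in> N"
    "\<And>\<sigma> x. \<sigma> \<in> inf_sym \<Longrightarrow> x \<in> N \<Longrightarrow> act M \<sigma> x \<in> N"
proof -
  have N: "submodule N ratfun_ring M"
    using assms by (simp add: subrep_def)
  show "N \<subseteq> carrier M" "\<And>x y. x \<in> N \<Longrightarrow> y \<in> N \<Longrightarrow> x \<oplus>\<^bsub>M\<^esub> y \<in> N"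
    "\<And>x. x \<in> N \<Longrightarrow> \<ominus>\<^bsub>M\<^esub> x \<in> N" "\<And>a x. x \<in> N \<Longrightarrow> a \<odot>\<^bsub>M\<^esub> x \<in> N"
    using submoduleE[OF N] by (auto simp: ratfun_ring_def)
  show "\<zero>\<^bsub>M\<^esub> \<in> N"
    using subgroup.one_closed[OF submodule.axioms(1)[OF N]] by simp
  show "\<And>\<sigma> x. \<sigma> \<in> inf_sym \<Longrightarrow> x \<in> N \<Longrightarrow> act M \<sigma> x \<in> N"
    using assms by (auto simp: subrep_def)
qed

lemma subrep_semirep:
  assumes "subrep N M"
  shows "smooth_semirep (M\<lparr>carrier := N\<rparr>)"
proof -
  have "submodule N ratfun_ring M"
    using assms by (simp add: subrep_def)
  then have "Module.module ratfun_ring (M\<lparr>carrier := N\<rparr>)"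
    by (rule submodule.submodule_is_module) unfold_locales
  moreover have "v \<in> carrier M" if "v \<in> N" for v
    using subrepD(1)[OF assms] that by blast
  ultimately show ?thesis
    using subrepD(6)[OF assms] act_id act_comp act_add act_smult smooth
    by (intro smooth_semirep.intro smooth_semirep_axioms.intro) simp_all
qed

text \<open>A vector fixed by \<open>inf_sym_fix n\<close> depends only on the points below
  \<open>n\<close>, so its image under a permutation depends only on where these points go.
  Formally, the quotient \<open>?\<rho>\<close> of the two permutations fixes those points.\<close>

lemma act_eq_if_agree:
  assumes v: "v \<in> carrier M" "\<And>\<rho>. \<rho> \<in> inf_sym_fix n \<Longrightarrow> act M \<rho> v = v"
    and \<sigma>: "\<sigma> \<in> inf_sym" "\<tau> \<in> inf_sym" "\<And>i. i < n \<Longrightarrow> \<sigma> i = \<tau> i"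
  shows "act M \<sigma> v = act M \<tau> v"
proof -
  let ?\<rho> = "inv_into UNIV \<tau> \<circ> \<sigma>"
  have "?\<rho> \<in> inf_sym_fix n"
    using \<sigma> by (auto simp: inf_sym_fix_def inf_sym_comp inf_sym_inv inf_sym_inj)
  then have "act M \<tau> (act M ?\<rho> v) = act M \<tau> v"
    by (simp add: v(2))
  moreover have "act M \<tau> (act M ?\<rho> v) = act M (\<tau> \<circ> ?\<rho>) v"
    using \<sigma> v(1) by (simp add: act_comp inf_sym_comp inf_sym_inv)
  moreover have "\<tau> \<circ> ?\<rho> = \<sigma>"
    by (simp add: inf_sym_comp_inv[OF \<sigma>(2)] flip: comp_assoc)
  ultimately show ?thesis
    by simp
qed

text \<open>This replaces \<sigma> by a conjugate that fixes a conveniently chosen point, provided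
  that the transposition already fixes \<open>v\<close>.\<close>

lemma act_conj_transpose:
  assumes "v \<in> carrier M" "\<sigma> \<in> inf_sym" "act M (Transposition.transpose a b) v = v"
    and "act M (Transposition.transpose a b \<circ> \<sigma> \<circ> Transposition.transpose a b) v = v"
  shows "act M \<sigma> v = v"
proof -
  let ?t = "Transposition.transpose a b"
  have "\<sigma> = ?t \<circ> (?t \<circ> \<sigma> \<circ> ?t) \<circ> ?t"
    by (rule ext) simp
  then have "act M \<sigma> v = act M (?t \<circ> (?t \<circ> \<sigma> \<circ> ?t) \<circ> ?t) v"
    by simp
  also have "\<dots> = act M ?t (act M (?t \<circ> \<sigma> \<circ> ?t) (act M ?t v))"
    using assms(1,2) by (simp add: act_comp inf_sym_comp act_closed del: comp_apply)
  also have "\<dots> = v"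
    by (simp add: assms)
  finally show ?thesis .
qed

text \<open>Here \<open>m\<close> involves only the points 0, ..., n, so \<open>Suc n\<close> is the
  first fresh point. Two kinds of permutations are shown to fix \<open>m'\<close>: those fixing 0,
  ..., n (\<open>A\<close>), and those fixing 0, ..., n - 1 and \<open>w\<close> (\<open>B\<close>).
  Any element of \<open>inf_sym_fix n\<close> is conjugate to one of kind \<open>A\<close> by a
  transposition of kind \<open>B\<close>.\<close>

lemma invariant_lift_step:
  assumes N: "subrep N M" and L: "point_retraction (M\<lparr>carrier := N\<rparr>) (Suc n) L"
    and m: "m \<in> carrier M" and fixed: "\<And>\<rho>. \<rho> \<in> inf_sym_fix (Suc n) \<Longrightarrow> act M \<rho> m = m"
    and mod: "\<And>\<sigma>. \<sigma> \<in> inf_sym_fix n \<Longrightarrow> \<exists>y\<in>N. act M \<sigma> m = m \<oplus>\<^bsub>M\<^esub> y"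
  shows "\<exists>y\<in>N. \<forall>\<sigma>\<in>inf_sym_fix n. act M \<sigma> (m \<oplus>\<^bsub>M\<^esub> y) = m \<oplus>\<^bsub>M\<^esub> y"
proof -
  define w where "w = Suc n"
  let ?t = "Transposition.transpose"
  note ND = subrepD[OF N]
  have NM: "x \<in> carrier M" if "x \<in> N" for x
    using ND(1) that by blast
  have LN: "L x \<in> N" if "x \<in> N" for x
    using L that by (auto simp: point_retraction_def)
  have L_add: "L (x \<oplus>\<^bsub>M\<^esub> y) = L x \<oplus>\<^bsub>M\<^esub> L y" if "x \<in> N" "y \<in> N" for x y
    using L that by (auto simp: point_retraction_def)
  have L_act: "L (act M \<sigma> x) = act M \<sigma> (L x)" if "\<sigma> \<in> inf_sym" "\<sigma> w = w" "x \<in> N" for \<sigma> x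
    using L that by (auto simp: point_retraction_def w_def)
  have L_fixed: "\<exists>k. \<forall>u>k. act M (?t w u) (L x) = L x" if "x \<in> N" for x
    using L that by (auto simp: point_retraction_def w_def)
  have L_id: "L x = x" if "x \<in> N" "\<forall>u>k. act M (?t w u) x = x" for x k
  proof -
    have "\<forall>x\<in>N. \<forall>k. (\<forall>u>k. act M (?t w u) x = x) \<longrightarrow> L x = x"
      using L by (simp add: point_retraction_def w_def)
    with that show ?thesis
      by blast
  qed
  have tn: "?t n w \<in> inf_sym_fix n"
    by (auto simp: inf_sym_fix_def w_def)
  obtain x where x: "x \<in> N" "act M (?t n w) m = m \<oplus>\<^bsub>M\<^esub> x"
    using mod[OF tn] by blast
  define m' where "m' = m \<oplus>\<^bsub>M\<^esub> L x"
  have m': "m' \<in> carrier M"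
    using m x LN NM by (simp add: m'_def)
  have A: "act M \<rho> m' = m'" if \<rho>: "\<rho> \<in> inf_sym_fix (Suc n)" for \<rho>
  proof -
    have \<rho>': "\<rho> \<in> inf_sym"
      using \<rho> by (simp add: inf_sym_fix_def)
    obtain k l where k: "\<forall>u>k. act M (?t w u) (L x) = L x" and l: "\<forall>u>l. \<rho> u = u"
      using L_fixed[OF x(1)] inf_sym_eventually_fix[OF \<rho>'] by blast
    \<comment> \<open>Since \<rho> need not fix \<open>w\<close>, it cannot be moved past
      \<open>L\<close> directly. It does fix the large point \<open>u\<close>, so conjugation by (w
      u) yields a permutation that fixes \<open>w\<close>, and (w u) itself fixes
      \<open>L x\<close>.\<close>
    define u where "u = Suc (max w (max k l))"
    let ?\<rho> = "?t w u \<circ> \<rho> \<circ> ?t w u"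
    have \<rho>_in: "?\<rho> \<in> inf_sym" "?\<rho> w = w"
      using l \<rho>' by (simp_all add: inf_sym_comp u_def)
    have \<rho>_fix: "?\<rho> i = i" if "i < Suc w" for i
    proof (cases "i = w")
      case False
      with that show ?thesis
        using \<rho> by (simp add: u_def w_def inf_sym_fix_def)
    qed (use \<rho>_in in simp)
    \<comment> \<open>The left vector is \<tau> m, which involves only the points 0, ..., n - 1 and
      \<open>w\<close>; all of them are fixed by \<open>?\<rho>\<close>.\<close>
    have "act M ?\<rho> (m \<oplus>\<^bsub>M\<^esub> x) = m \<oplus>\<^bsub>M\<^esub> x"
    proof -
      have "act M (?\<rho> \<circ> ?t n w) m = act M (?t n w) m"
      proof (rule act_eq_if_agree[OF m, where n = "Suc n"])
        fix i assume "i < Suc n"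
        then have "?t n w i < Suc w"
          by (cases "i = n") (auto simp: w_def)
        then show "(?\<rho> \<circ> ?t n w) i = ?t n w i"
          using \<rho>_fix by (metis comp_apply)
      qed (use \<rho>_in(1) fixed in \<open>simp_all add: inf_sym_comp\<close>)
      then show ?thesis
        using \<rho>_in(1) m by (simp add: act_comp x(2) del: comp_apply)
    qed
    moreover have "act M ?\<rho> m = m"
      using \<rho>_in(1) \<rho>_fix by (intro fixed) (simp add: inf_sym_fix_def w_def)
    ultimately have "m \<oplus>\<^bsub>M\<^esub> act M ?\<rho> x = m \<oplus>\<^bsub>M\<^esub> x"
      using \<rho>_in(1) m x NM by (simp add: act_add)
    then have "act M ?\<rho> x = x"
      using \<rho>_in(1) m x NM by (simp add: act_closed)
    then have "act M ?\<rho> (L x) = L x"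
      using L_act[OF \<rho>_in x(1)] by metis
    moreover have "act M (?t w u) (L x) = L x"
      using k by (simp add: u_def)
    ultimately have "act M \<rho> (L x) = L x"
      by (intro act_conj_transpose[OF NM[OF LN[OF x(1)]] \<rho>'])
    then show ?thesis
      using fixed[OF \<rho>] m \<rho>' x LN NM by (simp add: m'_def act_add)
  qed
  have B: "act M \<sigma> m' = m'" if \<sigma>: "\<sigma> \<in> inf_sym_fix n" "\<sigma> w = w" for \<sigma>
  proof -
    have \<sigma>': "\<sigma> \<in> inf_sym"
      using \<sigma> by (simp add: inf_sym_fix_def)
    obtain y where y: "y \<in> N" "act M \<sigma> m = m \<oplus>\<^bsub>M\<^esub> y"
      using mod[OF \<sigma>(1)] by blast
    obtain l where l: "\<forall>u>l. \<sigma> u = u"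
      using inf_sym_eventually_fix[OF \<sigma>'] by blast
    \<comment> \<open>Again \<tau> m involves only 0, ..., n - 1 and \<open>w\<close>, which
      \<sigma> fixes. Expanding both sides of this invariance gives \<open>x_eq\<close>, which
      exhibits the cocycle value \<open>y\<close> as the difference of \<open>x\<close> and its
      image under \<sigma>.\<close>
    have "act M (\<sigma> \<circ> ?t n w) m = act M (?t n w) m"
      by (rule act_eq_if_agree[OF m, where n = "Suc n"])
         (use \<sigma> \<sigma>' fixed in \<open>auto simp: inf_sym_comp less_Suc_eq w_def inf_sym_fix_def\<close>)
    then have "m \<oplus>\<^bsub>M\<^esub> x = m \<oplus>\<^bsub>M\<^esub> (y \<oplus>\<^bsub>M\<^esub> act M \<sigma> x)"
      using \<sigma>' m x y NM by (simp add: act_comp act_add act_closed a_assoc)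
    then have x_eq: "x = y \<oplus>\<^bsub>M\<^esub> act M \<sigma> x"
      using \<sigma>' m x y NM by (simp add: act_closed)
    \<comment> \<open>The vector \<open>y\<close> is free of \<open>w\<close>: (w u) fixes
      \<open>m\<close> and, as \<sigma> fixes both \<open>w\<close> and \<open>u\<close>, commutes
      with \<sigma>. Hence \<open>L\<close> keeps \<open>y\<close>, and applying \<open>L\<close> to
      \<open>x_eq\<close> replaces \<open>x\<close> by \<open>L x\<close> on both sides.\<close>
    have "act M (?t w u) y = y" if u: "u > max w l" for u
    proof -
      have "act M (?t w u \<circ> \<sigma>) m = act M (\<sigma> \<circ> ?t w u) m"
      proof -
        have "?t w u (\<sigma> i) = \<sigma> (?t w u i)" for i
          using l \<sigma>(2) u inj_eq[OF inf_sym_inj[OF \<sigma>']] by (auto simp: Transposition.transpose_def)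
        then have "?t w u \<circ> \<sigma> = \<sigma> \<circ> ?t w u"
          by (simp add: fun_eq_iff)
        then show ?thesis
          by simp
      qed
      moreover have tm: "act M (?t w u) m = m"
        using u by (intro fixed) (auto simp: inf_sym_fix_def w_def)
      ultimately have "m \<oplus>\<^bsub>M\<^esub> act M (?t w u) y = m \<oplus>\<^bsub>M\<^esub> y"
        using \<sigma>' m y NM by (simp add: act_comp act_add)
      then show ?thesis
        using m y NM by (simp add: act_closed)
    qed
    then have "L y = y"
      by (intro L_id[OF y(1), of "max w l"]) blast
    then have "L x = y \<oplus>\<^bsub>M\<^esub> act M \<sigma> (L x)"
      using arg_cong[OF x_eq, of L] x y \<sigma> \<sigma>' ND(6) by (simp add: L_add L_act)
    moreover have "act M \<sigma> m' = m \<oplus>\<^bsub>M\<^esub> (y \<oplus>\<^bsub>M\<^esub> act M \<sigma> (L x))"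
      using m x y \<sigma>' NM LN by (simp add: m'_def act_add act_closed a_assoc)
    ultimately show ?thesis
      by (simp add: m'_def)
  qed
  have "act M \<sigma> m' = m'" if \<sigma>: "\<sigma> \<in> inf_sym_fix n" for \<sigma>
  proof -
    have \<sigma>': "\<sigma> \<in> inf_sym"
      using \<sigma> by (simp add: inf_sym_fix_def)
    obtain l where l: "\<forall>u>l. \<sigma> u = u"
      using inf_sym_eventually_fix[OF \<sigma>'] by blast
    \<comment> \<open>Because \<sigma> fixes \<open>u\<close>, the conjugate of \<sigma> by (n u)
      fixes n as well, so it is of kind \<open>A\<close>. Taking \<open>u\<close> above
      \<open>w\<close> makes (n u) fix \<open>w\<close>, so it is of kind \<open>B\<close>.\<close>
    define u where "u = Suc (max w l)"
    have u: "u > w" "\<sigma> u = u"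
      using l by (simp_all add: u_def)
    have "act M (?t n u) m' = m'"
      by (rule B) (use u in \<open>auto simp: inf_sym_fix_def w_def\<close>)
    moreover have "act M (?t n u \<circ> \<sigma> \<circ> ?t n u) m' = m'"
      by (rule A) (use \<sigma> u in \<open>auto simp: inf_sym_fix_def inf_sym_comp less_Suc_eq w_def\<close>)
    ultimately show ?thesis
      by (rule act_conj_transpose[OF m' \<sigma>'])
  qed
  then show ?thesis
    using LN[OF x(1)] unfolding m'_def by blast
qed

text \<open>Invariance of the class modulo \<open>N\<close> is independent of the representative;
  this allows corrections from \<open>N\<close> to be made one after another.\<close>

lemma coset_shift:
  assumes "subrep N M" "m \<in> carrier M" "y \<in> N" "\<sigma> \<in> inf_sym" "\<exists>z\<in>N. act M \<sigma> m = m \<oplus>\<^bsub>M\<^esub> z"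
  shows "\<exists>z\<in>N. act M \<sigma> (m \<oplus>\<^bsub>M\<^esub> y) = (m \<oplus>\<^bsub>M\<^esub> y) \<oplus>\<^bsub>M\<^esub> z"
proof -
  note ND = subrepD[OF assms(1)]
  obtain z where z: "z \<in> N" "act M \<sigma> m = m \<oplus>\<^bsub>M\<^esub> z"
    using assms(5) by blast
  let ?z = "\<ominus>\<^bsub>M\<^esub> y \<oplus>\<^bsub>M\<^esub> (z \<oplus>\<^bsub>M\<^esub> act M \<sigma> y)"
  have C: "y \<in> carrier M" "z \<in> carrier M" "act M \<sigma> y \<in> carrier M"
    using ND(1) assms(3,4) z(1) act_closed by auto
  have "act M \<sigma> (m \<oplus>\<^bsub>M\<^esub> y) = m \<oplus>\<^bsub>M\<^esub> (z \<oplus>\<^bsub>M\<^esub> act M \<sigma> y)"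
    using assms C z by (simp add: act_add a_assoc)
  also have "\<dots> = (m \<oplus>\<^bsub>M\<^esub> y) \<oplus>\<^bsub>M\<^esub> ?z"
  proof -
    have "y \<oplus>\<^bsub>M\<^esub> ?z = z \<oplus>\<^bsub>M\<^esub> act M \<sigma> y"
      using C by (simp add: r_neg2)
    then show ?thesis
      using C assms(2) by (simp add: a_assoc)
  qed
  finally show ?thesis
    using ND(3,4,6) assms(3,4) z(1) by (intro bexI[of _ ?z]) auto
qed

text \<open>Each application of \<open>invariant_lift_step\<close> removes the largest point on
  which the lift may depend, until only the points below \<open>n\<close> remain. All corrections
  lie in \<open>N\<close> and are added up.\<close>

lemma invariant_lift_pointwise:
  assumes N: "subrep N M" and L: "\<And>w. \<exists>L. point_retraction (M\<lparr>carrier := N\<rparr>) w L"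
    and m: "m \<in> carrier M" and mod: "\<And>\<sigma>. \<sigma> \<in> inf_sym_fix n \<Longrightarrow> \<exists>y\<in>N. act M \<sigma> m = m \<oplus>\<^bsub>M\<^esub> y"
  shows "\<exists>y\<in>N. \<forall>\<sigma>\<in>inf_sym_fix n. act M \<sigma> (m \<oplus>\<^bsub>M\<^esub> y) = m \<oplus>\<^bsub>M\<^esub> y"
proof -
  note ND = subrepD[OF N]
  have mono: "inf_sym_fix b \<subseteq> inf_sym_fix a" if "a \<le> b" for a b
    using that by (auto simp: inf_sym_fix_def)
  have *: "\<exists>y\<in>N. \<forall>\<sigma>\<in>inf_sym_fix n. act M \<sigma> (m \<oplus>\<^bsub>M\<^esub> y) = m \<oplus>\<^bsub>M\<^esub> y"
    if "m \<in> carrier M" "\<And>\<rho>. \<rho> \<in> inf_sym_fix (n + k) \<Longrightarrow> act M \<rho> m = m"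
      "\<And>\<sigma>. \<sigma> \<in> inf_sym_fix n \<Longrightarrow> \<exists>y\<in>N. act M \<sigma> m = m \<oplus>\<^bsub>M\<^esub> y" for m k
    using that
  proof (induction k arbitrary: m)
    case 0
    then show ?case
      using ND(2) by (intro bexI[of _ "\<zero>\<^bsub>M\<^esub>"]) auto
  next
    case (Suc k)
    obtain L where L': "point_retraction (M\<lparr>carrier := N\<rparr>) (Suc (n + k)) L"
      using L by blast
    have "\<exists>y\<in>N. \<forall>\<sigma>\<in>inf_sym_fix (n + k). act M \<sigma> (m \<oplus>\<^bsub>M\<^esub> y) = m \<oplus>\<^bsub>M\<^esub> y"
      by (rule invariant_lift_step[OF N L' Suc.prems(1)]) (use Suc.prems mono[of n "n + k"] in auto)
    then obtain y where y: "y \<in> N" "\<And>\<sigma>. \<sigma> \<in> inf_sym_fix (n + k) \<Longrightarrow> act M \<sigma> (m \<oplus>\<^bsub>M\<^esub> y) = m \<oplus>\<^bsub>M\<^esub> y"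
      by blast
    have yM: "y \<in> carrier M"
      using ND(1) y(1) by blast
    have "\<exists>z\<in>N. \<forall>\<sigma>\<in>inf_sym_fix n. act M \<sigma> ((m \<oplus>\<^bsub>M\<^esub> y) \<oplus>\<^bsub>M\<^esub> z) = (m \<oplus>\<^bsub>M\<^esub> y) \<oplus>\<^bsub>M\<^esub> z"
    proof (rule Suc.IH)
      show "m \<oplus>\<^bsub>M\<^esub> y \<in> carrier M"
        using Suc.prems(1) yM by simp
      show "\<exists>z\<in>N. act M \<sigma> (m \<oplus>\<^bsub>M\<^esub> y) = (m \<oplus>\<^bsub>M\<^esub> y) \<oplus>\<^bsub>M\<^esub> z" if "\<sigma> \<in> inf_sym_fix n" for \<sigma>
        by (rule coset_shift[OF N Suc.prems(1) y(1) _ Suc.prems(3)[OF that]])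
           (use that in \<open>simp add: inf_sym_fix_def\<close>)
    qed (rule y(2))
    then obtain z where z: "z \<in> N"
      "\<And>\<sigma>. \<sigma> \<in> inf_sym_fix n \<Longrightarrow> act M \<sigma> ((m \<oplus>\<^bsub>M\<^esub> y) \<oplus>\<^bsub>M\<^esub> z) = (m \<oplus>\<^bsub>M\<^esub> y) \<oplus>\<^bsub>M\<^esub> z"
      by blast
    have "z \<in> carrier M"
      using ND(1) z(1) by blast
    then have "(m \<oplus>\<^bsub>M\<^esub> y) \<oplus>\<^bsub>M\<^esub> z = m \<oplus>\<^bsub>M\<^esub> (y \<oplus>\<^bsub>M\<^esub> z)"
      using Suc.prems(1) yM by (simp add: a_assoc)
    then show ?case
      using z y(1) ND(3) by (intro bexI[of _ "y \<oplus>\<^bsub>M\<^esub> z"]) auto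
  qed
  \<comment> \<open>The level k from smoothness may lie on either side of \<open>n\<close>; n + k is
    at least both, so the descent can start there.\<close>
  obtain k where "\<forall>\<sigma>\<in>inf_sym_fix k. act M \<sigma> m = m"
    using smooth[OF m] by blast
  then have "act M \<rho> m = m" if "\<rho> \<in> inf_sym_fix (n + k)" for \<rho>
    using mono[of k "n + k"] that by auto
  from *[OF m this mod] show ?thesis .
qed

end

section \<open>An element of trace one for a finite symmetric group\<close>

lemma ratfun_act_divide: "bij \<sigma> \<Longrightarrow> ratfun_act \<sigma> (x / y) = ratfun_act \<sigma> x / ratfun_act \<sigma> y"
  using ratfun_act_mult[of \<sigma> "x / y" y]
  by (cases "y = 0") (simp_all add: ratfun_act_eq_0_iff field_simps)

lemma ratfun_act_sum: "bij \<sigma> \<Longrightarrow> ratfun_act \<sigma> (sum f A) = (\<Sum>x\<in>A. ratfun_act \<sigma> (f x))"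
  by (induction A rule: infinite_finite_induct) (simp_all add: ratfun_act_add)

text \<open>A monomial with pairwise distinct exponents has pairwise distinct conjugates, so their sum is
  nonzero.\<close>

lemma ratfun_trace_one:
  "\<exists>a :: 'k::field ratfun. (\<Sum>\<pi> | \<pi> permutes {..<d}. ratfun_act \<pi> a) = 1 \<and>
    (\<forall>\<rho>\<in>inf_sym_fix d. ratfun_act \<rho> a = a)"
proof -
  let ?P = "{\<pi>. \<pi> permutes {..<d}}"
  have fin: "finite ?P"
    by (simp add: finite_permutations)
  have bij: "bij \<pi>" if "\<pi> permutes {..<d}" for \<pi>
    using that by (rule permutes_bij)
  \<comment> \<open>The exponent is \<open>Suc i\<close>, not i, so that the monomial contains
    exactly the variables below \<open>d\<close>: this separates those points from each other and
    from all points outside.\<close>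
  define e :: "nat \<Rightarrow>\<^sub>0 nat" where "e = (\<Sum>i<d. Poly_Mapping.single i (Suc i))"
  have e: "Poly_Mapping.lookup e i = (if i < d then Suc i else 0)" for i
    by (simp add: e_def Poly_Mapping.lookup_sum lookup_single when_def)
  define h :: "'k ratfun" where "h = ratfun_of_poly (Poly_Mapping.single e 1)"
  define t where "t = (\<Sum>\<pi>\<in>?P. ratfun_act \<pi> h)"
  have h: "ratfun_act \<pi> h = ratfun_of_poly (Poly_Mapping.single (pushforward \<pi> e) 1)" if "bij \<pi>" for \<pi>
    using that by (simp add: h_def ratfun_act_of_poly)
  have inj: "\<pi> = id" if \<pi>: "\<pi> permutes {..<d}" "pushforward \<pi> e = e" for \<pi>
  proof (rule ext)
    fix i
    show "\<pi> i = id i"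
    proof (cases "i < d")
      case True
      have "Poly_Mapping.lookup e (\<pi> i) = Poly_Mapping.lookup e i"
        using lookup_pushforward[OF bij[OF \<pi>(1)], of e i] \<pi>(2) by simp
      with True show ?thesis
        by (simp add: e split: if_splits)
    qed (use \<pi>(1) in \<open>simp add: permutes_def\<close>)
  qed
  have "t = ratfun_of_poly (\<Sum>\<pi>\<in>?P. Poly_Mapping.single (pushforward \<pi> e) 1)"
    by (simp add: t_def ratfun_of_poly_sum h bij)
  \<comment> \<open>Only the identity contributes to this coefficient, so it is 1 and the trace
    \<open>t\<close> is nonzero in every characteristic.\<close>
  moreover have "Poly_Mapping.lookup (\<Sum>\<pi>\<in>?P. Poly_Mapping.single (pushforward \<pi> e) (1 :: 'k)) e = 1"
  proof -
    have "Poly_Mapping.lookup (\<Sum>\<pi>\<in>?P. Poly_Mapping.single (pushforward \<pi> e) (1 :: 'k)) e =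
        (\<Sum>\<pi>\<in>?P. if \<pi> = id then 1 else 0)"
      unfolding Poly_Mapping.lookup_sum
      by (rule sum.cong) (use inj in \<open>auto simp: lookup_single when_def simp flip: id_def\<close>)
    then show ?thesis
      using fin by (simp add: permutes_id)
  qed
  ultimately have t: "t \<noteq> 0"
    by (metis lookup_zero ratfun_of_poly_eq_0_iff zero_neq_one)
  have t_perm: "ratfun_act \<pi> t = t" if "\<pi> permutes {..<d}" for \<pi>
  proof -
    have "ratfun_act \<pi> t = (\<Sum>\<tau>\<in>?P. ratfun_act (\<pi> \<circ> \<tau>) h)"
      using that by (simp add: t_def ratfun_act_sum bij ratfun_act_comp)
    also have "\<dots> = t"
      unfolding t_def
      by (rule sum.reindex_bij_betw[where h = "(\<circ>) \<pi>"])
         (use that in \<open>auto intro!: bij_betwI[where g = "(\<circ>) (inv_into UNIV \<pi>)"] permutes_compose permutes_inv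
            simp: permutes_inv_o simp flip: comp_assoc\<close>)
    finally show ?thesis .
  qed
  \<comment> \<open>This gives the second half of the claim: multiplying an
    \<open>inf_sym_fix d\<close>-invariant vector by the trace-one element must not destroy its
    invariance.\<close>
  have rho: "ratfun_act \<rho> (ratfun_act \<pi> h) = ratfun_act \<pi> h"
    if "\<rho> \<in> inf_sym_fix d" "\<pi> permutes {..<d}" for \<rho> \<pi>
  proof -
    have \<rho>: "bij \<rho>"
      using that by (auto simp: inf_sym_fix_def inf_sym_bij)
    have "pushforward (\<rho> \<circ> \<pi>) e = pushforward \<pi> e"
    proof (rule pushforward_cong)
      fix i assume "i \<in> Poly_Mapping.keys e"
      then have "\<pi> i < d"
        using permutes_in_image[OF that(2), of i] by (simp add: in_keys_iff e split: if_splits)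
      then show "(\<rho> \<circ> \<pi>) i = \<pi> i"
        using that(1) by (simp add: inf_sym_fix_def)
    qed
    then show ?thesis
      using \<rho> bij[OF that(2)] by (simp add: h ratfun_act_of_poly pushforward_comp)
  qed
  have rho_t: "ratfun_act \<rho> t = t" if "\<rho> \<in> inf_sym_fix d" for \<rho>
    using that inf_sym_bij[of \<rho>] by (simp add: t_def ratfun_act_sum rho inf_sym_fix_def)
  show ?thesis
  proof (intro exI[of _ "h / t"] conjI ballI)
    have "(\<Sum>\<pi>\<in>?P. ratfun_act \<pi> (h / t)) = (\<Sum>\<pi>\<in>?P. ratfun_act \<pi> h / t)"
      by (rule sum.cong) (simp_all add: bij ratfun_act_divide t_perm)
    also have "\<dots> = 1"
      using t by (simp add: t_def flip: sum_divide_distrib)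
    finally show "(\<Sum>\<pi>\<in>?P. ratfun_act \<pi> (h / t)) = 1" .
    fix \<rho> assume \<rho>: "\<rho> \<in> inf_sym_fix d"
    then have "bij \<rho>"
      by (simp add: inf_sym_fix_def inf_sym_bij)
    moreover have "ratfun_act \<rho> h = h"
      using rho[OF \<rho> permutes_id] by simp
    ultimately show "ratfun_act \<rho> (h / t) = h / t"
      using rho_t[OF \<rho>] by (simp add: ratfun_act_divide)
  qed
qed

section \<open>Invariants of setwise stabilizers, by averaging\<close>

context smooth_semirep
begin

lemma act_finsum:
  assumes "\<sigma> \<in> inf_sym" "f \<in> A \<rightarrow> carrier M"
  shows "act M \<sigma> (finsum M f A) = finsum M (\<lambda>x. act M \<sigma> (f x)) A"
  using assms(2)
proof (induction A rule: infinite_finite_induct)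
  case (insert x A)
  then show ?case
    using assms(1) by (simp add: act_add act_closed Pi_iff)
qed (use assms(1) in \<open>simp_all add: act_zero\<close>)

text \<open>Start from a lift \<open>m0\<close> that is invariant under the pointwise stabilizer and
  sum the conjugates of \<open>v\<close>, the multiple of \<open>m0\<close> by a trace-one element.
  Modulo \<open>N\<close> every conjugate of \<open>m0\<close> is \<open>m0\<close>, so the sum
  \<open>m1\<close> has the same class as \<open>m0\<close>.\<close>

lemma invariant_lift:
  assumes N: "subrep N M" and L: "\<And>w. \<exists>L. point_retraction (M\<lparr>carrier := N\<rparr>) w L"
    and m: "m \<in> carrier M"
    and mod: "\<And>\<sigma>. \<sigma> \<in> inf_sym \<Longrightarrow> \<sigma> ` {..<d} = {..<d} \<Longrightarrow> \<exists>y\<in>N. act M \<sigma> m = m \<oplus>\<^bsub>M\<^esub> y"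
  shows "\<exists>y\<in>N. \<forall>\<sigma>\<in>inf_sym. \<sigma> ` {..<d} = {..<d} \<longrightarrow> act M \<sigma> (m \<oplus>\<^bsub>M\<^esub> y) = m \<oplus>\<^bsub>M\<^esub> y"
proof -
  note ND = subrepD[OF N]
  let ?P = "{\<pi>. \<pi> permutes {..<d}}"
  have fin: "finite ?P"
    by (simp add: finite_permutations)
  have P: "\<pi> \<in> inf_sym" "\<pi> ` {..<d} = {..<d}" if "\<pi> permutes {..<d}" for \<pi>
    using that by (simp_all add: inf_sym_permutes permutes_image)
  have fix_image: "\<sigma> ` {..<d} = {..<d}" if "\<sigma> \<in> inf_sym_fix d" for \<sigma>
  proof -
    have "\<sigma> ` {..<d} = id ` {..<d}"
      by (rule image_cong) (use that in \<open>simp_all add: inf_sym_fix_def\<close>)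
    then show ?thesis
      by simp
  qed
  have mod': "\<exists>y\<in>N. act M \<sigma> m = m \<oplus>\<^bsub>M\<^esub> y" if "\<sigma> \<in> inf_sym_fix d" for \<sigma>
    by (rule mod) (use that fix_image in \<open>auto simp: inf_sym_fix_def\<close>)
  obtain y0 where y0: "y0 \<in> N" "\<And>\<sigma>. \<sigma> \<in> inf_sym_fix d \<Longrightarrow> act M \<sigma> (m \<oplus>\<^bsub>M\<^esub> y0) = m \<oplus>\<^bsub>M\<^esub> y0"
    using invariant_lift_pointwise[OF N L m mod'] by blast
  define m0 where "m0 = m \<oplus>\<^bsub>M\<^esub> y0"
  have NM: "x \<in> carrier M" if "x \<in> N" for x
    using ND(1) that by blast
  have m0: "m0 \<in> carrier M"
    using m y0 NM by (simp add: m0_def)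
  have mod0: "\<exists>z\<in>N. act M \<sigma> m0 = m0 \<oplus>\<^bsub>M\<^esub> z" if "\<sigma> \<in> inf_sym" "\<sigma> ` {..<d} = {..<d}" for \<sigma>
    unfolding m0_def by (rule coset_shift[OF N m y0(1) that(1) mod[OF that]])
  obtain a :: "'k ratfun" where a: "(\<Sum>\<pi>\<in>?P. ratfun_act \<pi> a) = 1"
    "\<And>\<rho>. \<rho> \<in> inf_sym_fix d \<Longrightarrow> ratfun_act \<rho> a = a"
    using ratfun_trace_one by blast
  define v where "v = a \<odot>\<^bsub>M\<^esub> m0"
  have v: "v \<in> carrier M"
    using m0 by (simp add: v_def)
  have v_fix: "act M \<rho> v = v" if "\<rho> \<in> inf_sym_fix d" for \<rho>
    using that a(2)[OF that] y0(2)[OF that] m0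
    by (simp add: v_def act_smult inf_sym_fix_def m0_def[symmetric])
  define m1 where "m1 = finsum M (\<lambda>\<pi>. act M \<pi> v) ?P"
  \<comment> \<open>Partial sums are congruent modulo \<open>N\<close> to a partial trace times
    \<open>m0\<close>; for \<open>A = ?P\<close> the factor is 1.\<close>
  have "\<exists>z\<in>N. finsum M (\<lambda>\<pi>. act M \<pi> v) A = (\<Sum>\<pi>\<in>A. ratfun_act \<pi> a) \<odot>\<^bsub>M\<^esub> m0 \<oplus>\<^bsub>M\<^esub> z"
    if "finite A" "A \<subseteq> ?P" for A
    using that
  proof (induction A)
    case empty
    then show ?case
      using ND(2) m0 by (intro bexI[of _ "\<zero>\<^bsub>M\<^esub>"]) (simp_all add: smult_0)
  next
    case (insert \<pi> A)
    then obtain z where z: "z \<in> N"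
      "finsum M (\<lambda>\<pi>. act M \<pi> v) A = (\<Sum>\<pi>\<in>A. ratfun_act \<pi> a) \<odot>\<^bsub>M\<^esub> m0 \<oplus>\<^bsub>M\<^esub> z"
      by blast
    have \<pi>: "\<pi> \<in> inf_sym" "\<pi> ` {..<d} = {..<d}"
      using insert.prems P by auto
    obtain y where y: "y \<in> N" "act M \<pi> m0 = m0 \<oplus>\<^bsub>M\<^esub> y"
      using mod0[OF \<pi>] by blast
    let ?z = "ratfun_act \<pi> a \<odot>\<^bsub>M\<^esub> y \<oplus>\<^bsub>M\<^esub> z"
    have "finsum M (\<lambda>\<pi>. act M \<pi> v) (insert \<pi> A) = act M \<pi> v \<oplus>\<^bsub>M\<^esub> finsum M (\<lambda>\<pi>. act M \<pi> v) A"
      by (rule finsum_insert) (use insert v P in \<open>auto intro!: act_closed\<close>)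
    also have "act M \<pi> v = ratfun_act \<pi> a \<odot>\<^bsub>M\<^esub> m0 \<oplus>\<^bsub>M\<^esub> ratfun_act \<pi> a \<odot>\<^bsub>M\<^esub> y"
      using \<pi> m0 y NM by (simp add: v_def act_smult smult_add_r)
    finally have "finsum M (\<lambda>\<pi>. act M \<pi> v) (insert \<pi> A) =
        (\<Sum>\<pi>\<in>insert \<pi> A. ratfun_act \<pi> a) \<odot>\<^bsub>M\<^esub> m0 \<oplus>\<^bsub>M\<^esub> ?z"
      using insert m0 y z NM by (simp add: smult_add_l a_ac)
    then show ?case
      using y z ND(3,5) by (intro bexI[of _ ?z]) auto
  qed
  from this[OF fin order_refl] obtain z where z: "z \<in> N" "m1 = m0 \<oplus>\<^bsub>M\<^esub> z"
    using m0 by (auto simp: m1_def a(1) smult_1)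
  have "act M \<sigma> m1 = m1" if \<sigma>: "\<sigma> \<in> inf_sym" "\<sigma> ` {..<d} = {..<d}" for \<sigma>
  proof -
    \<comment> \<open>Since \<open>v\<close> depends only on the points below \<open>d\<close>,
      \<sigma> acts on the summands like its restriction \<pi> to those points, that is, by left
      multiplication on the index set.\<close>
    define \<pi> where "\<pi> i = (if i < d then \<sigma> i else i)" for i
    have \<pi>: "\<pi> permutes {..<d}"
    proof (rule bij_imp_permutes)
      have "bij_betw \<sigma> {..<d} {..<d}"
        using \<sigma> inf_sym_inj[OF \<sigma>(1)] by (auto simp: bij_betw_def intro: inj_on_subset)
      then show "bij_betw \<pi> {..<d} {..<d}"
        by (subst bij_betw_cong[of _ _ \<sigma>]) (simp_all add: \<pi>_def)
    qed (simp add: \<pi>_def)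
    have "act M \<sigma> m1 = finsum M (\<lambda>\<tau>. act M \<sigma> (act M \<tau> v)) ?P"
      unfolding m1_def by (rule act_finsum) (use \<sigma> v P in \<open>auto intro!: act_closed\<close>)
    also have "\<dots> = finsum M (\<lambda>\<tau>. act M (\<pi> \<circ> \<tau>) v) ?P"
    proof (rule finsum_cong')
      fix \<tau> assume "\<tau> \<in> ?P"
      then have \<tau>: "\<tau> permutes {..<d}"
        by simp
      have "act M (\<sigma> \<circ> \<tau>) v = act M (\<pi> \<circ> \<tau>) v"
        by (rule act_eq_if_agree[OF v v_fix])
           (use \<sigma> P[OF \<tau>] P[OF \<pi>] permutes_in_image[OF \<tau>] in \<open>auto simp: inf_sym_comp \<pi>_def\<close>)
      then show "act M \<sigma> (act M \<tau> v) = act M (\<pi> \<circ> \<tau>) v"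
        using \<sigma> P[OF \<tau>] v by (simp add: act_comp)
    qed (use P \<pi> v in \<open>auto intro!: act_closed inf_sym_comp\<close>)
    also have "\<dots> = finsum M (\<lambda>\<tau>. act M \<tau> v) ((\<lambda>\<tau>. \<pi> \<circ> \<tau>) ` ?P)"
    proof (rule finsum_reindex[symmetric])
      show "inj_on ((\<circ>) \<pi>) ?P"
        using permutes_inj[OF \<pi>] by (auto intro!: inj_onI simp: fun_eq_iff inj_eq)
      show "(\<lambda>\<tau>. act M \<tau> v) \<in> (\<circ>) \<pi> ` ?P \<rightarrow> carrier M"
        using P \<pi> v by (auto intro!: act_closed inf_sym_comp)
    qed
    also have "(\<lambda>\<tau>. \<pi> \<circ> \<tau>) ` ?P = ?P"
      using image_compose_permutations_left[OF \<pi>] by auto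
    finally show ?thesis
      by (simp add: m1_def)
  qed
  moreover have "m1 = m \<oplus>\<^bsub>M\<^esub> (y0 \<oplus>\<^bsub>M\<^esub> z)"
    using z y0 m NM by (simp add: m0_def a_assoc)
  ultimately show ?thesis
    using ND(3)[OF y0(1) z(1)] by (intro bexI[of _ "y0 \<oplus>\<^bsub>M\<^esub> z"]) auto
qed

end

section \<open>Splitting extensions of standard objects\<close>

definition I_unit :: "'j set \<Rightarrow> 'j \<Rightarrow> nat set \<Rightarrow> 'j \<Rightarrow> nat set \<Rightarrow>\<^sub>0 'k::field ratfun" where
  "I_unit J j S = (\<lambda>i\<in>J. if i = j then Poly_Mapping.single S 1 else 0)"

lemma I_unit_closed:
  "j \<in> J \<Longrightarrow> S \<in> r_subsets (d j) \<Longrightarrow> I_unit J j S \<in> carrier (I_sum J d)"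
  by (auto simp: I_sum_carrier I_unit_def intro: finite_subset[of _ "{j}"])

lemma act_I_unit: "\<sigma> \<in> inf_sym \<Longrightarrow> act (I_sum J d) \<sigma> (I_unit J j S) = I_unit J j (\<sigma> ` S)"
proof -
  assume "\<sigma> \<in> inf_sym"
  then have "act (I_rep r) \<sigma> (Poly_Mapping.single S 1) = Poly_Mapping.single (\<sigma> ` S) 1" "act (I_rep r) \<sigma> 0 = 0" for r
    by (simp_all add: I_rep_def map_single_ratfun inf_sym_bij)
  then show ?thesis
    by (auto simp: I_sum_ops I_unit_def fun_eq_iff)
qed

lemma lookup_I_smult:
  "j \<in> J \<Longrightarrow> Poly_Mapping.lookup ((a \<odot>\<^bsub>I_sum J d\<^esub> x) j) S = a * Poly_Mapping.lookup (x j) S"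
  by (simp add: I_sum_ops Poly_Mapping.map.rep_eq when_def)

text \<open>A bijection onto \<open>S\<close> extends to a permutation of some {..<n} containing
  both sets, because their complements in it have equal size.\<close>

lemma inf_sym_transitive:
  assumes "S \<in> r_subsets d"
  shows "\<exists>\<sigma>\<in>inf_sym. \<sigma> ` {..<d} = S"
proof -
  have S: "finite S" "card S = d"
    using assms by (simp_all add: r_subsets_def)
  obtain n0 where "\<forall>i\<in>S. i < n0"
    using finite_nat_set_iff_bounded S(1) by blast
  define n where "n = max n0 d"
  have Sn: "S \<subseteq> {..<n}"
    using \<open>\<forall>i\<in>S. i < n0\<close> by (auto simp: n_def less_max_iff_disj)
  have dn: "{..<d} \<subseteq> {..<n}"
    by (auto simp: n_def)
  obtain f where f: "bij_betw f {..<d} S"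
    using finite_same_card_bij[of "{..<d}" S] S by auto
  have "card ({..<n} - {..<d}) = card ({..<n} - S)"
    using S Sn dn by (simp add: card_Diff_subset)
  then obtain g where g: "bij_betw g ({..<n} - {..<d}) ({..<n} - S)"
    using finite_same_card_bij[of "{..<n} - {..<d}" "{..<n} - S"] by auto
  define \<sigma> where "\<sigma> i = (if i < d then f i else if i < n then g i else i)" for i
  have 1: "bij_betw \<sigma> {..<d} S"
    using f by (subst bij_betw_cong[of _ _ f]) (simp_all add: \<sigma>_def)
  moreover have "bij_betw \<sigma> ({..<n} - {..<d}) ({..<n} - S)"
    using g by (subst bij_betw_cong[of _ _ g]) (simp_all add: \<sigma>_def)
  ultimately have "bij_betw \<sigma> ({..<d} \<union> ({..<n} - {..<d})) (S \<union> ({..<n} - S))"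
    by (rule bij_betw_combine) auto
  moreover have "{..<d} \<union> ({..<n} - {..<d}) = {..<n}" "S \<union> ({..<n} - S) = {..<n}"
    using Sn dn by (simp_all only: Un_Diff_cancel Un_absorb1)
  ultimately have "bij_betw \<sigma> {..<n} {..<n}"
    by (simp only:)
  then have "\<sigma> permutes {..<n}"
    using dn by (intro bij_imp_permutes) (auto simp: \<sigma>_def)
  then show ?thesis
    using 1 by (intro bexI[of _ \<sigma>]) (auto simp: bij_betw_def inf_sym_permutes)
qed

lemma I_sum_zero:
  assumes "x \<in> carrier (I_sum J d)" "x \<oplus>\<^bsub>I_sum J d\<^esub> x = x"
  shows "x = \<zero>\<^bsub>I_sum J d\<^esub>"
proof (rule extensionalityI)
  show "x \<in> extensional J"
    using assms(1) by (simp add: I_sum_carrier)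
  show "x j = \<zero>\<^bsub>I_sum J d\<^esub> j" if "j \<in> J" for j
    using fun_cong[OF assms(2), of j] that by (simp add: I_sum_ops)
qed (simp add: I_sum_ops)

section \<open>An equivariant section of a surjection onto a standard object\<close>

context smooth_semirep
begin

lemma hom_zero:
  assumes "q \<in> semirep_hom M (I_sum J d)"
  shows "q \<zero>\<^bsub>M\<^esub> = \<zero>\<^bsub>I_sum J d\<^esub>"
proof (rule I_sum_zero)
  show "q \<zero>\<^bsub>M\<^esub> \<in> carrier (I_sum J d)"
    using assms by (auto simp: semirep_hom_def)
  have "q (\<zero>\<^bsub>M\<^esub> \<oplus>\<^bsub>M\<^esub> \<zero>\<^bsub>M\<^esub>) = q \<zero>\<^bsub>M\<^esub> \<oplus>\<^bsub>I_sum J d\<^esub> q \<zero>\<^bsub>M\<^esub>"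
    using assms zero_closed by (auto simp: semirep_hom_def simp del: l_zero r_zero)
  then show "q \<zero>\<^bsub>M\<^esub> \<oplus>\<^bsub>I_sum J d\<^esub> q \<zero>\<^bsub>M\<^esub> = q \<zero>\<^bsub>M\<^esub>"
    by simp
qed

lemma hom_finsum:
  assumes "q \<in> semirep_hom M (I_sum J d)" "g \<in> A \<rightarrow> carrier M" "i \<in> J"
  shows "q (finsum M g A) i = (\<Sum>p\<in>A. q (g p) i)"
  using assms(2)
proof (induction A rule: infinite_finite_induct)
  case (insert x A)
  have "q (finsum M g (insert x A)) = q (g x) \<oplus>\<^bsub>I_sum J d\<^esub> q (finsum M g A)"
    using insert assms(1) by (simp add: semirep_hom_def Pi_iff)
  then show ?case
    using insert assms(3) by (simp add: I_sum_ops Pi_iff)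
qed (use assms hom_zero[OF assms(1)] in \<open>simp_all add: I_sum_ops\<close>)

text \<open>The basis of each summand is a single orbit, so it is enough to lift the vector indexed
  by {..<d j} with its setwise stabilizer and to transport this lift.\<close>

lemma lift_basis:
  assumes N: "subrep N M" and L: "\<And>w. \<exists>L. point_retraction (M\<lparr>carrier := N\<rparr>) w L"
    and q: "q \<in> semirep_hom M (I_sum J d)" "q ` carrier M = carrier (I_sum J d)"
    and ker: "\<And>v w. v \<in> carrier M \<Longrightarrow> w \<in> carrier M \<Longrightarrow> q v = q w \<longleftrightarrow> (\<exists>y\<in>N. v = w \<oplus>\<^bsub>M\<^esub> y)"
  shows "\<exists>b. \<forall>j\<in>J. \<forall>S\<in>r_subsets (d j). b j S \<in> carrier M \<and> q (b j S) = I_unit J j S \<and>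
    (\<forall>\<sigma>\<in>inf_sym. act M \<sigma> (b j S) = b j (\<sigma> ` S))"
proof -
  let ?D = "I_sum J d"
  have q_act: "q (act M \<sigma> v) = act ?D \<sigma> (q v)" if "\<sigma> \<in> inf_sym" "v \<in> carrier M" for \<sigma> v
    using q(1) that by (simp add: semirep_hom_def)
  have "\<exists>m\<in>carrier M. q m = I_unit J j {..<d j} \<and>
      (\<forall>\<sigma>\<in>inf_sym. \<sigma> ` {..<d j} = {..<d j} \<longrightarrow> act M \<sigma> m = m)" if j: "j \<in> J" for j
  proof -
    have "I_unit J j {..<d j} \<in> q ` carrier M"
      unfolding q(2) using j by (intro I_unit_closed) (simp_all add: r_subsets_def)
    then obtain m where m: "m \<in> carrier M" "q m = I_unit J j {..<d j}"
      by (metis imageE)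
    have "\<exists>y\<in>N. act M \<sigma> m = m \<oplus>\<^bsub>M\<^esub> y" if "\<sigma> \<in> inf_sym" "\<sigma> ` {..<d j} = {..<d j}" for \<sigma>
      using that m act_closed ker[of "act M \<sigma> m" m] by (simp add: q_act act_I_unit)
    from invariant_lift[OF N L m(1) this] obtain y where y: "y \<in> N"
      "\<forall>\<sigma>\<in>inf_sym. \<sigma> ` {..<d j} = {..<d j} \<longrightarrow> act M \<sigma> (m \<oplus>\<^bsub>M\<^esub> y) = m \<oplus>\<^bsub>M\<^esub> y"
      by blast
    have C: "m \<oplus>\<^bsub>M\<^esub> y \<in> carrier M"
      using m(1) y(1) subrepD(1)[OF N] by auto
    then have "q (m \<oplus>\<^bsub>M\<^esub> y) = q m"
      using ker[OF C m(1)] y(1) by blast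
    with y(2) m C show ?thesis
      by (intro bexI[of _ "m \<oplus>\<^bsub>M\<^esub> y"]) auto
  qed
  then obtain m where m: "\<And>j. j \<in> J \<Longrightarrow> m j \<in> carrier M" "\<And>j. j \<in> J \<Longrightarrow> q (m j) = I_unit J j {..<d j}"
    "\<And>j \<sigma>. j \<in> J \<Longrightarrow> \<sigma> \<in> inf_sym \<Longrightarrow> \<sigma> ` {..<d j} = {..<d j} \<Longrightarrow> act M \<sigma> (m j) = m j"
    by metis
  \<comment> \<open>The conditional form makes the choice of a transporting permutation total; for
    infinite S the identity is taken.\<close>
  have "\<forall>S. \<exists>\<sigma>. \<sigma> \<in> inf_sym \<and> (finite S \<longrightarrow> \<sigma> ` {..<card S} = S)"
  proof
    fix S :: "nat set"
    show "\<exists>\<sigma>. \<sigma> \<in> inf_sym \<and> (finite S \<longrightarrow> \<sigma> ` {..<card S} = S)"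
      using inf_sym_transitive[of S "card S"] inf_sym_id
      by (cases "finite S") (auto simp: r_subsets_def Bex_def)
  qed
  then obtain \<tau> where \<tau>: "\<And>S. \<tau> S \<in> inf_sym" "\<And>S. finite S \<Longrightarrow> \<tau> S ` {..<card S} = S"
    by metis
  have \<tau>_r: "\<tau> S ` {..<r} = S" if "S \<in> r_subsets r" for S r
    using \<tau>(2)[of S] that by (simp add: r_subsets_def)
  define b where "b j S = act M (\<tau> S) (m j)" for j S
  show ?thesis
  proof (intro exI[of _ b] ballI conjI)
    fix j S assume j: "j \<in> J" and S: "S \<in> r_subsets (d j)"
    show "b j S \<in> carrier M"
      using m(1)[OF j] \<tau>(1) by (simp add: b_def act_closed)
    show "q (b j S) = I_unit J j S"
      using m(1,2)[OF j] \<tau>(1)[of S] \<tau>_r[OF S] by (simp add: b_def q_act act_I_unit)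
    fix \<sigma> assume \<sigma>: "\<sigma> \<in> inf_sym"
    let ?T = "\<sigma> ` S"
    \<comment> \<open>Both \<open>\<tau> ?T\<close> and \<sigma> composed with
      \<open>\<tau> S\<close> carry {..<d j} to \<open>?T\<close>. They differ by an element of the
      setwise stabilizer, which fixes \<open>m j\<close>.\<close>
    let ?\<rho> = "inv_into UNIV (\<tau> ?T) \<circ> (\<sigma> \<circ> \<tau> S)"
    have T: "\<tau> ?T ` {..<d j} = ?T"
      by (rule \<tau>_r[OF inf_sym_image_r_subsets[OF \<sigma> S]])
    have \<rho>: "?\<rho> \<in> inf_sym"
      using \<sigma> \<tau>(1) by (intro inf_sym_comp inf_sym_inv)
    have "?\<rho> ` {..<d j} = inv_into UNIV (\<tau> ?T) ` \<sigma> ` \<tau> S ` {..<d j}"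
      by (simp only: image_comp)
    also have "\<dots> = inv_into UNIV (\<tau> ?T) ` \<tau> ?T ` {..<d j}"
      by (simp only: \<tau>_r[OF S] T)
    also have "\<dots> = {..<d j}"
      using inf_sym_inj[OF \<tau>(1)] by (simp add: image_inv_f_f)
    finally have "act M ?\<rho> (m j) = m j"
      by (rule m(3)[OF j \<rho>])
    then have "b j ?T = act M (\<tau> ?T) (act M ?\<rho> (m j))"
      by (simp add: b_def)
    also have "\<dots> = act M (\<tau> ?T \<circ> ?\<rho>) (m j)"
      using \<rho> \<tau>(1) m(1)[OF j] by (simp only: act_comp)
    also have "\<tau> ?T \<circ> ?\<rho> = \<sigma> \<circ> \<tau> S"
      using inf_sym_comp_inv(1)[OF \<tau>(1), of ?T] by (metis comp_assoc id_comp)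
    also have "act M (\<sigma> \<circ> \<tau> S) (m j) = act M \<sigma> (b j S)"
      using \<sigma> \<tau>(1) m(1)[OF j] by (simp only: act_comp b_def)
    finally show "act M \<sigma> (b j S) = b j ?T"
      by simp
  qed
qed

text \<open>The section is the linear extension of sending basis vectors to \<open>b\<close>;
  equivariance holds because the family \<open>b\<close> is permuted in the same way as the
  basis.\<close>

lemma section_exists:
  fixes J :: "'j set"
  assumes q: "q \<in> semirep_hom M (I_sum J d)"
    and b: "\<And>j S. j \<in> J \<Longrightarrow> S \<in> r_subsets (d j) \<Longrightarrow> b j S \<in> carrier M"
      "\<And>j S. j \<in> J \<Longrightarrow> S \<in> r_subsets (d j) \<Longrightarrow> q (b j S) = I_unit J j S"
      "\<And>j S \<sigma>. j \<in> J \<Longrightarrow> S \<in> r_subsets (d j) \<Longrightarrow> \<sigma> \<in> inf_sym \<Longrightarrow> act M \<sigma> (b j S) = b j (\<sigma> ` S)"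
  shows "\<exists>s\<in>semirep_hom (I_sum J d) M. \<forall>x\<in>carrier (I_sum J d). q (s x) = x"
proof -
  let ?D = "I_sum J d :: ('k ratfun, 'j \<Rightarrow> _) semirep"
  define g where "g x p = Poly_Mapping.lookup (x (fst p)) (snd p) \<odot>\<^bsub>M\<^esub> b (fst p) (snd p)"
    for x :: "'j \<Rightarrow> nat set \<Rightarrow>\<^sub>0 'k ratfun" and p
  define I where "I = (SIGMA j:J. r_subsets (d j))"
  define s where "s x = finsum M (g x) (I_support J x)" for x
  have g: "g x \<in> A \<rightarrow> carrier M" if "A \<subseteq> I" for x A
    using that b(1) by (fastforce simp: g_def I_def)
  have supp: "I_support J x \<subseteq> I" if "x \<in> carrier ?D" for x
    using that by (auto simp: I_support_def I_def I_sum_carrier)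
  \<comment> \<open>Supports may shrink under addition and scaling, so sums are compared over a
    common finite index set.\<close>
  have s_super: "s x = finsum M (g x) A" if "finite A" "I_support J x \<subseteq> A" "A \<subseteq> I" for x A
    unfolding s_def
  proof (rule add.finprod_mono_neutral_cong_left)
    fix p assume p: "p \<in> A - I_support J x"
    then have "Poly_Mapping.lookup (x (fst p)) (snd p) = 0" "b (fst p) (snd p) \<in> carrier M"
      using that(3) b(1) by (auto simp: I_support_def I_def in_keys_iff)
    then show "g x p = \<zero>\<^bsub>M\<^esub>"
      by (simp add: g_def smult_0)
  qed (use that g in auto)
  have s_closed: "s x \<in> carrier M" if "x \<in> carrier ?D" for x
    unfolding s_def by (rule finsum_closed) (use g supp[OF that] in auto)
  have "s \<in> semirep_hom ?D M"
    unfolding semirep_hom_def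
  proof (intro CollectI conjI ballI allI)
    show "s \<in> carrier ?D \<rightarrow> carrier M"
      using s_closed by auto
    fix x assume x: "x \<in> carrier ?D"
    note fin = finite_I_support
    show "s (x \<oplus>\<^bsub>?D\<^esub> y) = s x \<oplus>\<^bsub>M\<^esub> s y" if y: "y \<in> carrier ?D" for y
    proof -
      let ?A = "I_support J x \<union> I_support J y"
      have A: "finite ?A" "?A \<subseteq> I"
        using fin[OF x] fin[OF y] supp[OF x] supp[OF y] by auto
      have "I_support J (x \<oplus>\<^bsub>?D\<^esub> y) \<subseteq> ?A"
        by (auto simp: I_support_def I_sum_ops in_keys_iff lookup_add)
      then have "s (x \<oplus>\<^bsub>?D\<^esub> y) = finsum M (g (x \<oplus>\<^bsub>?D\<^esub> y)) ?A"
        using A by (intro s_super)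
      also have "\<dots> = finsum M (\<lambda>p. g x p \<oplus>\<^bsub>M\<^esub> g y p) ?A"
        by (rule finsum_cong') (use A(2) b(1) in \<open>auto simp: g_def I_def I_sum_ops lookup_add smult_add_l\<close>)
      also have "\<dots> = s x \<oplus>\<^bsub>M\<^esub> s y"
        using A g[OF A(2)] by (simp add: s_super[of ?A] finsum_addf)
      finally show ?thesis .
    qed
    show "s (a \<odot>\<^bsub>?D\<^esub> x) = a \<odot>\<^bsub>M\<^esub> s x" for a
    proof -
      have "I_support J (a \<odot>\<^bsub>?D\<^esub> x) \<subseteq> I_support J x"
        by (auto simp: I_support_def in_keys_iff lookup_I_smult)
      then have "s (a \<odot>\<^bsub>?D\<^esub> x) = finsum M (g (a \<odot>\<^bsub>?D\<^esub> x)) (I_support J x)"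
        using fin[OF x] supp[OF x] by (intro s_super)
      also have "\<dots> = finsum M (\<lambda>p. a \<odot>\<^bsub>M\<^esub> g x p) (I_support J x)"
        by (rule finsum_cong')
           (use supp[OF x] b(1) in \<open>auto simp: g_def I_def lookup_I_smult smult_mult\<close>)
      also have "\<dots> = a \<odot>\<^bsub>M\<^esub> s x"
        unfolding s_def using fin[OF x] g[OF supp[OF x]]
        by (intro finsum_smult_ldistr[symmetric]) (simp_all add: ratfun_ring_def)
      finally show ?thesis .
    qed
    fix \<sigma> assume \<sigma>: "\<sigma> \<in> inf_sym"
    let ?h = "\<lambda>p. (fst p, \<sigma> ` snd p)"
    have bij: "bij ((`) \<sigma>)"
      by (rule bij_image_set[OF inf_sym_bij[OF \<sigma>]])
    have "I_support J (act ?D \<sigma> x) = ?h ` I_support J x"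
    proof (intro equalityI subsetI)
      fix p assume p: "p \<in> I_support J (act ?D \<sigma> x)"
      obtain T where T: "snd p = \<sigma> ` T"
        using bij by (metis bij_pointE)
      have "(fst p, T) \<in> I_support J x"
        using p lookup_I_sum_act[OF \<sigma>, of "fst p" J d x T] T inf_sym_bij[OF \<sigma>]
        by (auto simp: I_support_def in_keys_iff ratfun_act_eq_0_iff)
      moreover have "p = ?h (fst p, T)"
        using T by (simp add: prod_eq_iff)
      ultimately show "p \<in> ?h ` I_support J x"
        by (rule rev_image_eqI)
    next
      fix p assume "p \<in> ?h ` I_support J x"
      then show "p \<in> I_support J (act ?D \<sigma> x)"
        using \<sigma> by (auto simp: I_support_def in_keys_iff lookup_I_sum_act ratfun_act_eq_0_iff inf_sym_bij)
    qed
    then have "s (act ?D \<sigma> x) = finsum M (g (act ?D \<sigma> x)) (?h ` I_support J x)"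
      by (simp add: s_def)
    also have "\<dots> = finsum M (\<lambda>p. g (act ?D \<sigma> x) (?h p)) (I_support J x)"
    proof (rule finsum_reindex)
      show "g (act ?D \<sigma> x) \<in> ?h ` I_support J x \<rightarrow> carrier M"
        by (rule g) (use supp[OF x] inf_sym_image_r_subsets[OF \<sigma>] in \<open>auto simp: I_def\<close>)
      show "inj_on ?h (I_support J x)"
        using inf_sym_inj[OF \<sigma>] by (auto intro!: inj_onI simp: inj_image_eq_iff)
    qed
    also have "\<dots> = finsum M (\<lambda>p. act M \<sigma> (g x p)) (I_support J x)"
    proof (rule finsum_cong')
      fix p assume "p \<in> I_support J x"
      then have "fst p \<in> J" "snd p \<in> r_subsets (d (fst p))"
        using supp[OF x] by (auto simp: I_def)
      then show "g (act ?D \<sigma> x) (?h p) = act M \<sigma> (g x p)"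
        using \<sigma> b by (simp add: g_def act_smult lookup_I_sum_act)
    qed (use g[OF supp[OF x]] \<sigma> in \<open>auto intro: act_closed\<close>)
    also have "\<dots> = act M \<sigma> (s x)"
      unfolding s_def by (rule act_finsum[symmetric, OF \<sigma> g[OF supp[OF x]]])
    finally show "s (act ?D \<sigma> x) = act M \<sigma> (s x)" .
  qed
  moreover have "q (s x) = x" if x: "x \<in> carrier ?D" for x
  proof (rule I_sum_eqI)
    have "q (s x) \<in> carrier ?D"
      using q s_closed[OF x] by (auto simp: semirep_hom_def)
    then show "q (s x) \<in> extensional J" "x \<in> extensional J"
      using x by (simp_all add: I_sum_carrier)
    fix i T assume i: "i \<in> J"
    have "Poly_Mapping.lookup (q (s x) i) T = (\<Sum>p\<in>I_support J x. Poly_Mapping.lookup (q (g x p) i) T)"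
      unfolding s_def by (simp add: hom_finsum[OF q g[OF supp[OF x]] i] Poly_Mapping.lookup_sum)
    also have "\<dots> = (\<Sum>p\<in>I_support J x. if p = (i, T) then Poly_Mapping.lookup (x i) T else 0)"
    proof (rule sum.cong)
      fix p assume "p \<in> I_support J x"
      then have p: "fst p \<in> J" "snd p \<in> r_subsets (d (fst p))"
        using supp[OF x] by (auto simp: I_def)
      have "q (g x p) = Poly_Mapping.lookup (x (fst p)) (snd p) \<odot>\<^bsub>?D\<^esub> I_unit J (fst p) (snd p)"
        using q b(1)[OF p] b(2)[OF p] by (simp add: g_def semirep_hom_def)
      then show "Poly_Mapping.lookup (q (g x p) i) T = (if p = (i, T) then Poly_Mapping.lookup (x i) T else 0)"
        using i by (auto simp: lookup_I_smult I_unit_def lookup_single when_def prod_eq_iff)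
    qed simp
    also have "\<dots> = Poly_Mapping.lookup (x i) T"
      using finite_I_support[OF x] i by (simp add: I_support_def in_keys_iff)
    finally show "Poly_Mapping.lookup (q (s x) i) T = Poly_Mapping.lookup (x i) T" .
  qed
  ultimately show ?thesis
    by blast
qed

section \<open>Assembling a standard object from two summands\<close>

lemma standard_pair:
  assumes f: "f1 \<in> semirep_hom M (I_sum J1 d1)" "f2 \<in> semirep_hom M (I_sum J2 d2)"
    and inj: "\<And>v w. v \<in> carrier M \<Longrightarrow> w \<in> carrier M \<Longrightarrow> f1 v = f1 w \<Longrightarrow> f2 v = f2 w \<Longrightarrow> v = w"
    and surj: "\<And>x y. x \<in> carrier (I_sum J1 d1) \<Longrightarrow> y \<in> carrier (I_sum J2 d2) \<Longrightarrow>
      \<exists>v\<in>carrier M. f1 v = x \<and> f2 v = y"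
  shows "standard M"
proof (rule standardI)
  let ?D1 = "I_sum J1 d1 :: ('k ratfun, _) semirep" and ?D2 = "I_sum J2 d2 :: ('k ratfun, _) semirep"
  \<comment> \<open>The two families of summands are indexed jointly by a disjoint union;
    \<open>standardI\<close> accepts an index set of any type.\<close>
  let ?J = "Sum_Type.Plus J1 J2"
  let ?d = "case_sum d1 d2"
  let ?D = "I_sum ?J ?d :: ('k ratfun, _) semirep"
  define F where "F v = (\<lambda>k\<in>?J. case_sum (f1 v) (f2 v) k)" for v
  have mem: "F v \<in> carrier ?D" if "v \<in> carrier M" for v
  proof -
    have 1: "f1 v \<in> carrier ?D1" "f2 v \<in> carrier ?D2"
      using f that by (auto simp: semirep_hom_def)
    have "{k \<in> ?J. F v k \<noteq> 0} = Inl ` {j \<in> J1. f1 v j \<noteq> 0} \<union> Inr ` {j \<in> J2. f2 v j \<noteq> 0}"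
      by (auto simp: F_def)
    moreover have "Poly_Mapping.keys (F v k) \<subseteq> r_subsets (?d k)" if "k \<in> ?J" for k
      using that 1 by (elim PlusE) (simp_all add: I_sum_carrier F_def InlI InrI)
    ultimately show ?thesis
      using 1 by (simp add: I_sum_carrier) (simp add: F_def)
  qed
  have eqI: "x = y" if "x \<in> extensional ?J" "y \<in> extensional ?J"
    "\<And>j. j \<in> J1 \<Longrightarrow> x (Inl j) = y (Inl j)" "\<And>j. j \<in> J2 \<Longrightarrow> x (Inr j) = y (Inr j)" for x y :: "_ \<Rightarrow> nat set \<Rightarrow>\<^sub>0 'k ratfun"
    by (rule extensionalityI[OF that(1,2)]) (use that(3,4) in auto)
  have "F \<in> semirep_hom M ?D"
    unfolding semirep_hom_def
    by (intro CollectI conjI ballI allI)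
       (use f mem in \<open>auto intro!: eqI simp: semirep_hom_def F_def I_sum_ops InlI InrI\<close>)
  moreover have "bij_betw F (carrier M) (carrier ?D)"
    unfolding bij_betw_def
  proof (intro conjI equalityI subsetI)
    show "inj_on F (carrier M)"
    proof (rule inj_onI)
      fix v w assume v: "v \<in> carrier M" and w: "w \<in> carrier M" and eq: "F v = F w"
      have "f1 v \<in> extensional J1" "f1 w \<in> extensional J1" "f2 v \<in> extensional J2" "f2 w \<in> extensional J2"
        using f v w by (auto simp: semirep_hom_def I_sum_carrier Pi_iff)
      moreover have "f1 v j = f1 w j" if "j \<in> J1" for j
        using fun_cong[OF eq, of "Inl j"] that by (simp add: F_def InlI)
      moreover have "f2 v j = f2 w j" if "j \<in> J2" for j
        using fun_cong[OF eq, of "Inr j"] that by (simp add: F_def InrI)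
      ultimately have "f1 v = f1 w" "f2 v = f2 w"
        by (auto intro: extensionalityI)
      then show "v = w"
        by (rule inj[OF v w])
    qed
    show "z \<in> carrier ?D" if "z \<in> F ` carrier M" for z
      using that mem by auto
    show "z \<in> F ` carrier M" if z: "z \<in> carrier ?D" for z
    proof -
      let ?x = "\<lambda>j\<in>J1. z (Inl j)" and ?y = "\<lambda>j\<in>J2. z (Inr j)"
      have "finite (Inl -` {k \<in> ?J. z k \<noteq> 0})" "finite (Inr -` {k \<in> ?J. z k \<noteq> 0})"
        by (intro finite_vimageI; use z in \<open>simp add: I_sum_carrier\<close>)+
      moreover have "{j \<in> J1. ?x j \<noteq> 0} = Inl -` {k \<in> ?J. z k \<noteq> 0}"
        "{j \<in> J2. ?y j \<noteq> 0} = Inr -` {k \<in> ?J. z k \<noteq> 0}"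
        by auto
      moreover have "Poly_Mapping.keys (z (Inl j)) \<subseteq> r_subsets (d1 j)" if "j \<in> J1" for j
        using z InlI[OF that, of J2] unfolding I_sum_carrier by (metis sum.case(1))
      moreover have "Poly_Mapping.keys (z (Inr j)) \<subseteq> r_subsets (d2 j)" if "j \<in> J2" for j
        using z InrI[OF that, of J1] unfolding I_sum_carrier by (metis sum.case(2))
      ultimately have "?x \<in> carrier ?D1" "?y \<in> carrier ?D2"
        by (simp_all add: I_sum_carrier)
      then obtain v where v: "v \<in> carrier M" "f1 v = ?x" "f2 v = ?y"
        using surj by blast
      have "F v = z"
        by (rule eqI) (use v z in \<open>auto simp: F_def I_sum_carrier InlI InrI\<close>)
      then show ?thesis
        using v(1) by blast
    qed
  qed
  ultimately show "semirep_isomorphic M ?D"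
    unfolding semirep_isomorphic_def by blast
qed

text \<open>With a section \<open>s\<close> of \<open>q\<close>, the map \<open>t\<close> is the
  projection onto the image of \<open>s\<close>, and its complement \<open>r\<close> is a retraction
  of \<open>M\<close> onto \<open>N\<close>. The pair consisting of \<open>f \<circ> r\<close> and
  \<open>q\<close> identifies \<open>M\<close> with the sum of both standard objects.\<close>

lemma standard_split:
  assumes N: "subrep N M"
    and f: "f \<in> semirep_hom (M\<lparr>carrier := N\<rparr>) (I_sum J1 d1)" "bij_betw f N (carrier (I_sum J1 d1))"
    and q: "q \<in> semirep_hom M (I_sum J2 d2)" "q ` carrier M = carrier (I_sum J2 d2)"
    and ker: "\<And>v w. v \<in> carrier M \<Longrightarrow> w \<in> carrier M \<Longrightarrow> q v = q w \<longleftrightarrow> (\<exists>y\<in>N. v = w \<oplus>\<^bsub>M\<^esub> y)"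
  shows "standard M"
proof -
  note ND = subrepD[OF N]
  let ?D2 = "I_sum J2 d2 :: ('k ratfun, _) semirep"
  have NM: "y \<in> carrier M" if "y \<in> N" for y
    using ND(1) that by blast
  have L: "\<exists>L. point_retraction (M\<lparr>carrier := N\<rparr>) w L" for w
  proof -
    obtain L where "point_retraction (I_sum J1 d1 :: ('k ratfun, _) semirep) w L"
      using I_sum_point_retraction by blast
    then show ?thesis
      using f by (intro point_retraction_iso[OF subrep_semirep[OF N] f(1)]) simp_all
  qed
  obtain b where "\<forall>j\<in>J2. \<forall>S\<in>r_subsets (d2 j). b j S \<in> carrier M \<and> q (b j S) = I_unit J2 j S \<and>
    (\<forall>\<sigma>\<in>inf_sym. act M \<sigma> (b j S) = b j (\<sigma> ` S))"
    using lift_basis[OF N L q ker] by blast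
  then have "\<exists>s\<in>semirep_hom ?D2 M. \<forall>x\<in>carrier ?D2. q (s x) = x"
    by (intro section_exists[OF q(1), of b]) auto
  then obtain s where s: "s \<in> semirep_hom ?D2 M" and qs: "\<And>x. x \<in> carrier ?D2 \<Longrightarrow> q (s x) = x"
    by blast
  define t where "t v = s (q v)" for v
  have qM: "q v \<in> carrier ?D2" if "v \<in> carrier M" for v
    using q that by auto
  have tM: "t v \<in> carrier M" if "v \<in> carrier M" for v
    using s qM[OF that] by (auto simp: t_def semirep_hom_def)
  have t_add: "t (v \<oplus>\<^bsub>M\<^esub> w) = t v \<oplus>\<^bsub>M\<^esub> t w" if "v \<in> carrier M" "w \<in> carrier M" for v w
    using s q(1) that qM by (simp add: t_def semirep_hom_def)
  have t_smult: "t (a \<odot>\<^bsub>M\<^esub> v) = a \<odot>\<^bsub>M\<^esub> t v" if "v \<in> carrier M" for a v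
    using s q(1) that qM by (simp add: t_def semirep_hom_def)
  have t_act: "t (act M \<sigma> v) = act M \<sigma> (t v)" if "\<sigma> \<in> inf_sym" "v \<in> carrier M" for \<sigma> v
    using s q(1) that qM by (simp add: t_def semirep_hom_def)
  have "\<exists>y\<in>N. v = t v \<oplus>\<^bsub>M\<^esub> y" if "v \<in> carrier M" for v
    using ker[OF that tM[OF that]] qs[OF qM[OF that]] by (simp add: t_def)
  then obtain r where r: "\<And>v. v \<in> carrier M \<Longrightarrow> r v \<in> N" "\<And>v. v \<in> carrier M \<Longrightarrow> v = t v \<oplus>\<^bsub>M\<^esub> r v"
    by metis
  \<comment> \<open>The \<open>N\<close>-component is unique by cancellation; the linearity and
    equivariance of \<open>r\<close> follow by exhibiting a decomposition.\<close>
  have r_eq: "r v = y" if "v \<in> carrier M" "y \<in> N" "v = t v \<oplus>\<^bsub>M\<^esub> y" for v y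
  proof -
    have "t v \<oplus>\<^bsub>M\<^esub> r v = t v \<oplus>\<^bsub>M\<^esub> y"
      using r(2)[OF that(1)] that(3) by simp
    moreover have "t v \<in> carrier M" "r v \<in> carrier M" "y \<in> carrier M"
      using that(1,2) r(1)[OF that(1)] tM NM by auto
    ultimately show ?thesis
      by simp
  qed
  have r_add: "r (v \<oplus>\<^bsub>M\<^esub> w) = r v \<oplus>\<^bsub>M\<^esub> r w" if v: "v \<in> carrier M" and w: "w \<in> carrier M" for v w
  proof (rule r_eq)
    have C: "t v \<in> carrier M" "t w \<in> carrier M" "r v \<in> carrier M" "r w \<in> carrier M"
      using v w tM r(1) NM by auto
    have "v \<oplus>\<^bsub>M\<^esub> w = (t v \<oplus>\<^bsub>M\<^esub> r v) \<oplus>\<^bsub>M\<^esub> (t w \<oplus>\<^bsub>M\<^esub> r w)"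
      using r(2)[OF v] r(2)[OF w] by simp
    also have "\<dots> = (t v \<oplus>\<^bsub>M\<^esub> t w) \<oplus>\<^bsub>M\<^esub> (r v \<oplus>\<^bsub>M\<^esub> r w)"
      using C by (simp add: a_ac)
    finally show "v \<oplus>\<^bsub>M\<^esub> w = t (v \<oplus>\<^bsub>M\<^esub> w) \<oplus>\<^bsub>M\<^esub> (r v \<oplus>\<^bsub>M\<^esub> r w)"
      unfolding t_add[OF v w] .
  qed (use v w r ND(3) in auto)
  have r_smult: "r (a \<odot>\<^bsub>M\<^esub> v) = a \<odot>\<^bsub>M\<^esub> r v" if v: "v \<in> carrier M" for a v
  proof (rule r_eq)
    have "a \<odot>\<^bsub>M\<^esub> v = a \<odot>\<^bsub>M\<^esub> (t v \<oplus>\<^bsub>M\<^esub> r v)"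
      using r(2)[OF v] by simp
    also have "\<dots> = t (a \<odot>\<^bsub>M\<^esub> v) \<oplus>\<^bsub>M\<^esub> a \<odot>\<^bsub>M\<^esub> r v"
      using v tM r(1)[OF v] NM by (simp add: t_smult smult_add_r)
    finally show "a \<odot>\<^bsub>M\<^esub> v = t (a \<odot>\<^bsub>M\<^esub> v) \<oplus>\<^bsub>M\<^esub> a \<odot>\<^bsub>M\<^esub> r v" .
  qed (use v r ND(5) in auto)
  have r_act: "r (act M \<sigma> v) = act M \<sigma> (r v)" if \<sigma>: "\<sigma> \<in> inf_sym" and v: "v \<in> carrier M" for \<sigma> v
  proof (rule r_eq)
    have "act M \<sigma> v = act M \<sigma> (t v \<oplus>\<^bsub>M\<^esub> r v)"
      using r(2)[OF v] by simp
    also have "\<dots> = t (act M \<sigma> v) \<oplus>\<^bsub>M\<^esub> act M \<sigma> (r v)"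
      using v \<sigma> tM r(1)[OF v] NM by (simp add: t_act act_add)
    finally show "act M \<sigma> v = t (act M \<sigma> v) \<oplus>\<^bsub>M\<^esub> act M \<sigma> (r v)" .
  qed (use v \<sigma> r ND(6) act_closed in auto)
  show ?thesis
  proof (rule standard_pair[of "f \<circ> r" J1 d1 q J2 d2])
    show "f \<circ> r \<in> semirep_hom M (I_sum J1 d1)"
      using f(1) r(1) by (auto simp: semirep_hom_def r_add r_smult r_act Pi_iff)
    fix v w assume v: "v \<in> carrier M" and w: "w \<in> carrier M" and eq: "(f \<circ> r) v = (f \<circ> r) w" "q v = q w"
    have "r v = r w"
      using eq(1) f(2) r(1)[OF v] r(1)[OF w] by (auto simp: bij_betw_def dest: inj_onD)
    then show "v = w"
      using r(2)[OF v] r(2)[OF w] eq(2) by (simp add: t_def)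
  next
    fix x y assume x: "x \<in> carrier (I_sum J1 d1 :: ('k ratfun, _) semirep)" and y: "y \<in> carrier ?D2"
    obtain z where z: "z \<in> N" "f z = x"
      using f(2) x by (metis bij_betw_imp_surj_on imageE)
    have sy: "s y \<in> carrier M"
      using s y by (auto simp: semirep_hom_def)
    let ?v = "s y \<oplus>\<^bsub>M\<^esub> z"
    have v: "?v \<in> carrier M"
      using sy NM[OF z(1)] by simp
    have qv: "q ?v = y"
      using ker[OF v sy] z(1) qs[OF y] by auto
    have "r ?v = z"
      by (rule r_eq[OF v z(1)]) (simp add: t_def qv)
    then show "\<exists>v\<in>carrier M. (f \<circ> r) v = x \<and> q v = y"
      using v qv z(2) by (intro bexI[of _ ?v]) auto
  qed (rule q(1))
qed

text \<open>The quotient is traded for the surjection \<open>q\<close>, the composite of the coset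
  map with the given isomorphism, whose fibres are the cosets of \<open>N\<close>.\<close>

lemma standard_extension:
  assumes N: "subrep N M" and std: "standard (M\<lparr>carrier := N\<rparr>)" "standard (quot_semirep M N)"
  shows "standard M"
proof -
  note ND = subrepD[OF N]
  have NM: "y \<in> carrier M" if "y \<in> N" for y
    using ND(1) that by blast
  let ?Q = "quot_semirep M N"
  have sub: "subgroup N (add_monoid M)"
    using N by (simp add: subrep_def submodule_def)
  interpret abelian_subgroup N M
    by (rule abelian_subgroupI3[OF additive_subgroup.intro[OF sub]]) unfold_locales
  have coset: "N +>\<^bsub>M\<^esub> u = N +>\<^bsub>M\<^esub> v \<longleftrightarrow> (\<exists>y\<in>N. u = v \<oplus>\<^bsub>M\<^esub> y)"
    if "u \<in> carrier M" "v \<in> carrier M" for u v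
  proof -
    have "N +>\<^bsub>M\<^esub> u = N +>\<^bsub>M\<^esub> v \<longleftrightarrow> u \<in> N +>\<^bsub>M\<^esub> v"
      using that a_repr_independence' a_rcos_self by metis
    also have "\<dots> \<longleftrightarrow> (\<exists>y\<in>N. u = v \<oplus>\<^bsub>M\<^esub> y)"
      using that NM by (auto simp: a_r_coset_def' a_comm)
    finally show ?thesis .
  qed
  \<comment> \<open>Scalars and permutations act on the quotient by a union over all
    representatives; for a map respecting \<open>N\<close> all members of this union
    coincide.\<close>
  have coset_map: "(\<Union>u\<in>N +>\<^bsub>M\<^esub> v. N +>\<^bsub>M\<^esub> g u) = N +>\<^bsub>M\<^esub> g v"
    if v: "v \<in> carrier M" and g: "\<And>y. y \<in> N \<Longrightarrow> g (v \<oplus>\<^bsub>M\<^esub> y) = g v \<oplus>\<^bsub>M\<^esub> g y"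
      "\<And>y. y \<in> N \<Longrightarrow> g y \<in> N" "g v \<in> carrier M" for g v
  proof -
    have "N +>\<^bsub>M\<^esub> g u = N +>\<^bsub>M\<^esub> g v" if u: "u \<in> N +>\<^bsub>M\<^esub> v" for u
    proof -
      obtain y where "y \<in> N" "u = y \<oplus>\<^bsub>M\<^esub> v"
        using u by (auto simp: a_r_coset_def')
      then have "y \<in> N" "u = v \<oplus>\<^bsub>M\<^esub> y"
        using v NM a_comm by auto
      then show ?thesis
        using g NM by (subst coset) auto
    qed
    moreover have "v \<in> N +>\<^bsub>M\<^esub> v"
      using v by (rule a_rcos_self)
    ultimately show ?thesis
      by blast
  qed
  obtain J1 :: "'b set" and d1 f where f: "f \<in> semirep_hom (M\<lparr>carrier := N\<rparr>) (I_sum J1 d1)"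
    "bij_betw f N (carrier (I_sum J1 d1))"
    using std(1) by (auto simp: standard_def semirep_isomorphic_def)
  obtain J2 :: "'b set set" and d2 h where h: "h \<in> semirep_hom ?Q (I_sum J2 d2)"
    "bij_betw h (carrier ?Q) (carrier (I_sum J2 d2))"
    using std(2) by (auto simp: standard_def semirep_isomorphic_def)
  define q where "q v = h (N +>\<^bsub>M\<^esub> v)" for v
  have QC: "N +>\<^bsub>M\<^esub> v \<in> carrier ?Q" if "v \<in> carrier M" for v
    using a_rcosetsI[OF ND(1) that] by (simp add: quot_semirep_def)
  show ?thesis
  proof (rule standard_split[OF N f])
    show "q \<in> semirep_hom M (I_sum J2 d2)"
      unfolding semirep_hom_def
    proof (intro CollectI conjI ballI allI)
      show "q \<in> carrier M \<rightarrow> carrier (I_sum J2 d2)"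
        using h(2) QC by (auto simp: q_def bij_betw_def)
      fix v assume v: "v \<in> carrier M"
      show "q (v \<oplus>\<^bsub>M\<^esub> w) = q v \<oplus>\<^bsub>I_sum J2 d2\<^esub> q w" if w: "w \<in> carrier M" for w
      proof -
        have "N +>\<^bsub>M\<^esub> (v \<oplus>\<^bsub>M\<^esub> w) = (N +>\<^bsub>M\<^esub> v) \<oplus>\<^bsub>?Q\<^esub> (N +>\<^bsub>M\<^esub> w)"
          using a_rcos_sum[OF v w] by (simp add: quot_semirep_def)
        then show ?thesis
          using h(1) QC v w by (simp add: q_def semirep_hom_def)
      qed
      show "q (a \<odot>\<^bsub>M\<^esub> v) = a \<odot>\<^bsub>I_sum J2 d2\<^esub> q v" for a
      proof -
        have "N +>\<^bsub>M\<^esub> (a \<odot>\<^bsub>M\<^esub> v) = a \<odot>\<^bsub>?Q\<^esub> (N +>\<^bsub>M\<^esub> v)"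
          using coset_map[OF v, of "\<lambda>u. a \<odot>\<^bsub>M\<^esub> u"] v NM ND(5) by (simp add: quot_semirep_def smult_add_r)
        then show ?thesis
          using h(1) QC v by (simp add: q_def semirep_hom_def)
      qed
      fix \<sigma> assume \<sigma>: "\<sigma> \<in> inf_sym"
      have "N +>\<^bsub>M\<^esub> act M \<sigma> v = act ?Q \<sigma> (N +>\<^bsub>M\<^esub> v)"
        using coset_map[OF v, of "act M \<sigma>"] v \<sigma> NM ND(6) by (simp add: quot_semirep_def act_add act_closed)
      then show "q (act M \<sigma> v) = act (I_sum J2 d2) \<sigma> (q v)"
        using h(1) QC v \<sigma> by (simp add: q_def semirep_hom_def)
    qed
    have "carrier ?Q = (\<lambda>v. N +>\<^bsub>M\<^esub> v) ` carrier M"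
      by (auto simp: quot_semirep_def A_RCOSETS_def')
    then show "q ` carrier M = carrier (I_sum J2 d2)"
      using bij_betw_imp_surj_on[OF h(2)] by (simp add: q_def image_image)
    fix v w assume v: "v \<in> carrier M" and w: "w \<in> carrier M"
    have "q v = q w \<longleftrightarrow> N +>\<^bsub>M\<^esub> v = N +>\<^bsub>M\<^esub> w"
      using h(2) QC[OF v] QC[OF w] by (auto simp: q_def bij_betw_def dest: inj_onD)
    then show "q v = q w \<longleftrightarrow> (\<exists>y\<in>N. v = w \<oplus>\<^bsub>M\<^esub> y)"
      using coset[OF v w] by simp
  qed
qed

text \<open>The zero object is the empty direct sum; this starts the induction along the
  filtration.\<close>

lemma standard_zero: "standard (M\<lparr>carrier := {\<zero>\<^bsub>M\<^esub>}\<rparr>)"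
proof (rule standardI)
  let ?D = "I_sum ({} :: nat set) (\<lambda>_. 0) :: ('k ratfun, _) semirep"
  have D: "carrier ?D = {\<zero>\<^bsub>?D\<^esub>}"
    by (auto simp: I_sum_carrier I_sum_ops restrict_def)
  show "semirep_isomorphic (M\<lparr>carrier := {\<zero>\<^bsub>M\<^esub>}\<rparr>) ?D"
    unfolding semirep_isomorphic_def
  proof (rule bexI[of _ "\<lambda>_. \<zero>\<^bsub>?D\<^esub>"])
    show "bij_betw (\<lambda>_. \<zero>\<^bsub>?D\<^esub>) (carrier (M\<lparr>carrier := {\<zero>\<^bsub>M\<^esub>}\<rparr>)) (carrier ?D)"
      by (simp add: D bij_betw_def)
  qed (auto simp: semirep_hom_def I_sum_ops I_sum_carrier)
qed

end

theorem corollary4p5: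
  fixes M :: "('k::field ratfun, 'b) semirep"
  assumes "smooth_semirep M"
    and "semi_standard M"
  shows "standard M"
proof -
  interpret smooth_semirep M
    by (rule assms(1))
  obtain n F where F: "F 0 = {\<zero>\<^bsub>M\<^esub>}" "F n = carrier M" "\<And>i. i \<le> n \<Longrightarrow> subrep (F i) M"
    "\<And>i. i < n \<Longrightarrow> F i \<subseteq> F (Suc i) \<and> standard (quot_semirep (M\<lparr>carrier := F (Suc i)\<rparr>) (F i))"
    using assms(2) unfolding semi_standard_def by blast
  have "standard (M\<lparr>carrier := F i\<rparr>)" if "i \<le> n" for i
    using that
  proof (induction i)
    case 0
    show ?case
      unfolding F(1) by (rule standard_zero)
  next
    case (Suc i)
    let ?M = "M\<lparr>carrier := F (Suc i)\<rparr>"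
    interpret S: smooth_semirep ?M
      by (rule subrep_semirep[OF F(3)[OF Suc.prems]])
    have Fi: "subrep (F i) M" "F i \<subseteq> F (Suc i)"
      using F(3,4)[of i] Suc.prems by auto
    interpret Fi: smooth_semirep "M\<lparr>carrier := F i\<rparr>"
      by (rule subrep_semirep[OF Fi(1)])
    \<comment> \<open>The filtration steps are subobjects of \<open>M\<close>, but the splitting
      takes place inside \<open>F (Suc i)\<close>, so \<open>F i\<close> has to be recognized as a
      subobject there.\<close>
    have "submodule (F i) ratfun_ring ?M"
      by (rule S.module_incl_imp_submodule) (use Fi(2) Fi.module_axioms in simp_all)
    then have "subrep (F i) ?M"
      using Fi(1) by (simp add: subrep_def)
    then show ?case
      using Suc F(4)[of i] by (intro S.standard_extension[of "F i"]) simp_all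
  qed
  from this[of n] show ?thesis
    by (simp add: F(2))
qed

end
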